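(* Let $n\ge 2$ and let $*:(\mathcal{K}^n_s)^2\to\mathcal{K}^n_s$ be an operation. Then $*$ is projection covariant, associative, and has polynomial volume if and only if one of the following holds: (a) $K*L=\{o\}$ for all $K,L\in\mathcal{K}^n_s$; (b) $K*L=K$ for all $K,L\in\mathcal{K}^n_s$; (c) $K*L=L$ for all $K,L\in\mathcal{K}^n_s$; (d) $*$ is Minkowski addition, i.e. $K*L=K+L$ for all $K,L\in\mathcal{K}^n_s$.
   Context: $\mathcal{K}^n_s$ is the class of nonempty compact convex subsets of $\mathbb{R}^n$ that are $o$-symmetric ($K=-K$), where $o$ is the origin. $K+L=\{x+y:x\in K,y\in L\}$. $\mathcal{H}^n$ denotes $n$-dimensional Hausdorff measure (volume) in $\mathbb{R}^n$. Properties of $*$ (for all $K,L,N\in\mathcal{K}^n_s$): projection covariant: $(K*L)|S=(K|S)*(L|S)$ for every linear subspace $S$ of $\mathbb{R}^n$ of dimension $k$, $1\le k\le n-1$, where $X|S$ is the orthogonal projection of $X$ onto $S$ (regarded as a subset of $\mathbb{R}^n$); associative: $K*(L*N)=(K*L)*N$; polynomial volume: for all $K,L\in\mathcal{K}^n_s$ there are $m(K,L)\in\mathbb{N}\cup\{0\}$ and real coefficients $a_{ij}(K,L)$ such that $$\mathcal{H}^n\big((rK)*(sL)\big)=\sum_{i,j=0}^{m(K,L)}a_{ij}(K,L)\,r^is^j\quad\text{for all } r,s\ge 0.$$ *)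

theory Defs
  imports "HOL-Analysis.Analysis" "HOL-Library.Set_Algebras"
begin

(* Set negation is written as an image, since "- K" is the complement of K in HOL. *)
definition symmetric_bodies :: "(real ^ 'n) set set" where
  "symmetric_bodies = {K. K \<noteq> {} \<and> compact K \<and> convex K \<and> uminus ` K = K}"

definition orth_proj :: "(real ^ 'n) set \<Rightarrow> real ^ 'n \<Rightarrow> real ^ 'n" where
  "orth_proj S x = (THE y. y \<in> S \<and> (\<forall>z\<in>S. orthogonal (x - y) z))"

(* An operation on symmetric bodies is a total function on sets; every property below only
   refers to its values on symmetric bodies. *)
type_synonym 'n body_op = "(real ^ 'n) set \<Rightarrow> (real ^ 'n) set \<Rightarrow> (real ^ 'n) set"

definition projection_covariant :: "'n::finite body_op \<Rightarrow> bool" where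
  "projection_covariant f \<longleftrightarrow>
     (\<forall>K\<in>symmetric_bodies. \<forall>L\<in>symmetric_bodies. \<forall>S.
        subspace S \<and> 1 \<le> dim S \<and> dim S \<le> CARD('n) - 1 \<longrightarrow>
        orth_proj S ` f K L = f (orth_proj S ` K) (orth_proj S ` L))"

definition associative_op :: "'n::finite body_op \<Rightarrow> bool" where
  "associative_op f \<longleftrightarrow>
     (\<forall>K\<in>symmetric_bodies. \<forall>L\<in>symmetric_bodies. \<forall>N\<in>symmetric_bodies.
        f K (f L N) = f (f K L) N)"

(* The n-dimensional Hausdorff measure on real ^ 'n is Lebesgue measure. *)
definition polynomial_volume :: "'n::finite body_op \<Rightarrow> bool" where
  "polynomial_volume f \<longleftrightarrow>
     (\<forall>K\<in>symmetric_bodies. \<forall>L\<in>symmetric_bodies.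
        \<exists>(m::nat) (a :: nat \<Rightarrow> nat \<Rightarrow> real). \<forall>r\<ge>0. \<forall>s\<ge>0.
          measure lebesgue (f ((\<lambda>x. r *\<^sub>R x) ` K) ((\<lambda>x. s *\<^sub>R x) ` L)) =
            (\<Sum>i\<le>m. \<Sum>j\<le>m. a i j * r ^ i * s ^ j))"

end

theory Submission
  imports Defs "HOL-Computational_Algebra.Polynomial"
begin

text \<open>
  Projecting onto lines shows that \<open>h(K * L, u) = \<phi>(h(K, u), h(L, u))\<close> for support functions, where
  \<open>\<phi>\<close> is homogeneous of degree one because lines at all angles are available when \<open>n \<ge> 2\<close>. Applying
  \<open>*\<close> to two orthogonal segments bounds \<open>\<phi>(s, t)\<close> between its values on the axes and their sum, and
  associativity forces \<open>\<phi>(1, 0)\<close> and \<open>\<phi>(0, 1)\<close> to be 0 or 1. The only case left open is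
  \<open>\<phi>(1, 0) = \<phi>(0, 1) = 1\<close>. Polynomial volume for dilates of a cube makes \<open>\<phi>(1, t)\<^sup>n\<close> a polynomial, so
  \<open>\<phi>(1, t) = 1 + C t\<^sup>k + o(t\<^sup>k)\<close>, and comparing the terms of order \<open>t\<^sup>k\<close> in the associativity equation
  gives \<open>\<phi>(s, t)\<^sup>k = s\<^sup>k + t\<^sup>k\<close>. Polynomial volume for a cube and the dilates of a segment excludes
  \<open>k \<ge> 2\<close>, since that volume grows linearly but has derivative 0 at 0.

  Conversely, Minkowski addition has polynomial volume by Gromov's argument: for finite \<open>P\<close> the gradient
  of \<open>u\<^sub>P(x) = log (\<Sum>y\<in>P. exp (y \<bullet> x))\<close> has image dense in the hull of \<open>P\<close>, and
  \<open>r \<nabla>u\<^sub>P + s \<nabla>u\<^sub>Q\<close> maps the space injectively onto \<open>r conv P + s conv Q\<close> up to a null set. The volume is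
  therefore the integral of the determinant of \<open>r D\<^sup>2u\<^sub>P + s D\<^sup>2u\<^sub>Q\<close>, a polynomial in \<open>r\<close> and \<open>s\<close>.
\<close>

subsection \<open>The gradient of log-sum-exp\<close>

definition lse :: "'a::euclidean_space set \<Rightarrow> 'a \<Rightarrow> real" where
  "lse P x = ln (\<Sum>y\<in>P. exp (y \<bullet> x))"

definition softmax :: "'a::euclidean_space set \<Rightarrow> 'a \<Rightarrow> 'a \<Rightarrow> real" where
  "softmax P x y = exp (y \<bullet> x) / (\<Sum>z\<in>P. exp (z \<bullet> x))"

definition grad_lse :: "'a::euclidean_space set \<Rightarrow> 'a \<Rightarrow> 'a" where
  "grad_lse P x = (\<Sum>y\<in>P. softmax P x y *\<^sub>R y)"

text \<open>The covariance operator of the weights \<open>softmax P x\<close>. Centring only one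
  factor gives the same operator, because the weighted centred values
  \<open>(y - grad_lse P x) \<bullet> v\<close> sum to zero.\<close>

definition hess_lse :: "'a::euclidean_space set \<Rightarrow> 'a \<Rightarrow> 'a \<Rightarrow> 'a" where
  "hess_lse P x v = (\<Sum>y\<in>P. (softmax P x y * ((y - grad_lse P x) \<bullet> v)) *\<^sub>R y)"

lemma sum_exp_pos:
  assumes "finite P" "P \<noteq> {}"
  shows "(\<Sum>y\<in>P. exp (y \<bullet> x)) > (0::real)"
  using assms by (intro sum_pos) auto

lemma softmax_pos: "finite P \<Longrightarrow> P \<noteq> {} \<Longrightarrow> softmax P x y > 0"
  unfolding softmax_def using sum_exp_pos[of P x] by simp

lemma sum_softmax:
  assumes "finite P" "P \<noteq> {}"
  shows "(\<Sum>y\<in>P. softmax P x y) = 1"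
  unfolding softmax_def using sum_exp_pos[OF assms, of x] 
  by (simp add: sum_divide_distrib[symmetric])

lemma grad_lse_in_hull:
  assumes "finite P" "P \<noteq> {}"
  shows "grad_lse P x \<in> convex hull P"
  unfolding grad_lse_def
  by (rule convex_sum[OF assms(1) convex_convex_hull])
    (use softmax_pos[OF assms] sum_softmax[OF assms] hull_inc in \<open>auto intro: less_imp_le\<close>)

text \<open>A single exponential is at most the whole sum, and half-spaces are convex. Thus
  \<open>lse P\<close> dominates the support function of the hull, which later gives
  coercivity.\<close>

lemma lse_ge:
  assumes "finite P" "p \<in> convex hull P"
  shows "p \<bullet> x \<le> lse P x"
proof -
  have "y \<bullet> x \<le> lse P x" if "y \<in> P" for y
  proof -
    have "exp (y \<bullet> x) \<le> (\<Sum>y\<in>P. exp (y \<bullet> x))"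
      using assms(1) that by (intro member_le_sum) auto
    then show ?thesis
      unfolding lse_def by (metis exp_gt_zero less_le_trans ln_exp ln_le_cancel_iff)
  qed
  then have "P \<subseteq> {p. x \<bullet> p \<le> lse P x}"
    by (auto simp: inner_commute)
  then have "convex hull P \<subseteq> {p. x \<bullet> p \<le> lse P x}"
    by (rule hull_minimal) (rule convex_halfspace_le)
  then show ?thesis using assms(2) by (auto simp: inner_commute)
qed

lemma lse_has_derivative:
  assumes "finite P" "P \<noteq> {}"
  shows "(lse P has_derivative (\<lambda>v. grad_lse P x \<bullet> v)) (at x)"
proof -
  let ?Z = "\<Sum>y\<in>P. exp (y \<bullet> x)"
  have "(lse P has_derivative (\<lambda>v. (\<Sum>y\<in>P. exp (y \<bullet> x) * (y \<bullet> v)) / ?Z)) (at x)"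
    unfolding lse_def
    by (rule derivative_eq_intros refl sum_exp_pos assms | simp)+ (simp add: divide_inverse mult.commute)
  moreover have "(\<Sum>y\<in>P. exp (y \<bullet> x) * (y \<bullet> v)) / ?Z = grad_lse P x \<bullet> v" for v
    by (simp add: grad_lse_def softmax_def inner_sum_left sum_divide_distrib)
  ultimately show ?thesis by simp
qed

text \<open>Quotient rule for the weighted mean, written as the moment sum \<open>S\<close> over the
  partition sum \<open>Z\<close>. Differentiating \<open>1 / Z\<close> produces the term that
  centres the weights.\<close>

lemma grad_lse_has_derivative:
  assumes "finite P" "P \<noteq> {}"
  shows "(grad_lse P has_derivative hess_lse P x) (at x)"
proof -
  define Z where "Z x = (\<Sum>y\<in>P. exp (y \<bullet> x))" for x
  define S where "S x = (\<Sum>y\<in>P. exp (y \<bullet> x) *\<^sub>R y)" for x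
  have Z: "Z x > 0" using sum_exp_pos[OF assms] by (simp add: Z_def)
  have dZ: "(Z has_derivative (\<lambda>v. \<Sum>y\<in>P. exp (y \<bullet> x) * (y \<bullet> v))) (at x)"
    unfolding Z_def by (rule derivative_eq_intros refl | simp)+ (simp add: mult.commute)
  have dS: "(S has_derivative (\<lambda>v. \<Sum>y\<in>P. (exp (y \<bullet> x) * (y \<bullet> v)) *\<^sub>R y)) (at x)"
    unfolding S_def by (rule derivative_eq_intros refl | simp)+ (simp add: mult.commute)
  have g: "grad_lse P = (\<lambda>x. inverse (Z x) *\<^sub>R S x)"
    by (auto simp: grad_lse_def softmax_def Z_def S_def scaleR_sum_right divide_inverse mult.commute)
  have "(grad_lse P has_derivative (\<lambda>v. inverse (Z x) *\<^sub>R (\<Sum>y\<in>P. (exp (y \<bullet> x) * (y \<bullet> v)) *\<^sub>R y)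
     + (- (inverse (Z x) * (\<Sum>y\<in>P. exp (y \<bullet> x) * (y \<bullet> v)) * inverse (Z x))) *\<^sub>R S x)) (at x)"
    unfolding g by (rule has_derivative_scaleR[OF Deriv.has_derivative_inverse[OF _ dZ] dS]) (use Z in simp)
  moreover have "inverse (Z x) *\<^sub>R (\<Sum>y\<in>P. (exp (y \<bullet> x) * (y \<bullet> v)) *\<^sub>R y)
     + (- (inverse (Z x) * (\<Sum>y\<in>P. exp (y \<bullet> x) * (y \<bullet> v)) * inverse (Z x))) *\<^sub>R S x = hess_lse P x v" for v
  proof -
    have m: "inverse (Z x) * (\<Sum>y\<in>P. exp (y \<bullet> x) * (y \<bullet> v)) = grad_lse P x \<bullet> v"
      by (simp add: g S_def inner_sum_left)
    have "hess_lse P x v = (\<Sum>y\<in>P. (softmax P x y * (y \<bullet> v)) *\<^sub>R y) - (grad_lse P x \<bullet> v) *\<^sub>R (\<Sum>y\<in>P. softmax P x y *\<^sub>R y)"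
      by (simp add: hess_lse_def inner_diff_left right_diff_distrib scaleR_diff_left sum_subtractf scaleR_sum_right mult_ac)
    also have "(\<Sum>y\<in>P. softmax P x y *\<^sub>R y) = inverse (Z x) *\<^sub>R S x"
      using fun_cong[OF g, of x] unfolding grad_lse_def .
    also have "(\<Sum>y\<in>P. (softmax P x y * (y \<bullet> v)) *\<^sub>R y) = inverse (Z x) *\<^sub>R (\<Sum>y\<in>P. (exp (y \<bullet> x) * (y \<bullet> v)) *\<^sub>R y)"
      by (simp add: softmax_def Z_def scaleR_sum_right divide_inverse mult_ac)
    finally show ?thesis unfolding m by simp
  qed
  ultimately show ?thesis by (simp add: fun_eq_iff)
qed

text \<open>The quadratic form is the variance of \<open>y \<bullet> v\<close> under the softmax
  weights; the cross term with the mean vanishes because the centred values have mean zero.\<close>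

lemma inner_hess_lse:
  assumes "finite P" "P \<noteq> {}"
  shows "v \<bullet> hess_lse P x v = (\<Sum>y\<in>P. softmax P x y * ((y - grad_lse P x) \<bullet> v)\<^sup>2)"
proof -
  let ?m = "grad_lse P x"
  have "(\<Sum>y\<in>P. softmax P x y * ((y - ?m) \<bullet> v)) = grad_lse P x \<bullet> v - (\<Sum>y\<in>P. softmax P x y) * (?m \<bullet> v)"
    by (simp add: grad_lse_def inner_diff_left algebra_simps sum_subtractf sum_distrib_right inner_sum_left)
  then have 0: "(\<Sum>y\<in>P. softmax P x y * ((y - ?m) \<bullet> v)) = 0"
    by (simp add: sum_softmax[OF assms])
  have "(\<Sum>y\<in>P. softmax P x y * ((y - ?m) \<bullet> v)\<^sup>2) = 
     (\<Sum>y\<in>P. softmax P x y * ((y - ?m) \<bullet> v) * (y \<bullet> v)) - (\<Sum>y\<in>P. softmax P x y * ((y - ?m) \<bullet> v)) * (?m \<bullet> v)"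
    by (simp add: power2_eq_square inner_diff_left algebra_simps sum_subtractf sum.distrib sum_distrib_right sum_distrib_left)
  also have "\<dots> = v \<bullet> hess_lse P x v"
    unfolding 0 by (simp add: hess_lse_def inner_sum_right inner_commute)
  finally show ?thesis by simp
qed

lemma inner_hess_lse_nonneg:
  assumes "finite P" "P \<noteq> {}"
  shows "v \<bullet> hess_lse P x v \<ge> 0"
  unfolding inner_hess_lse[OF assms] using softmax_pos[OF assms] by (intro sum_nonneg) (simp add: less_imp_le)

text \<open>Zero variance under strictly positive weights means that \<open>y \<bullet> v\<close>
  equals its mean at every point of \<open>P\<close>.\<close>

lemma inner_hess_lse_eq_0:
  assumes "finite P" "P \<noteq> {}" "v \<bullet> hess_lse P x v = 0" "y \<in> P"
  shows "y \<bullet> v = grad_lse P x \<bullet> v"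
proof -
  have "softmax P x y * ((y - grad_lse P x) \<bullet> v)\<^sup>2 = 0"
    using assms(3,4) unfolding inner_hess_lse[OF assms(1,2)]
    by (subst (asm) sum_nonneg_eq_0_iff) (use assms softmax_pos[OF assms(1,2)] in \<open>auto simp: less_imp_le\<close>)
  then show ?thesis using softmax_pos[OF assms(1,2), of x y] by (simp add: inner_diff_left)
qed

section \<open>Minkowski combinations and the combined gradient map\<close>

definition mink_comb :: "real \<Rightarrow> real \<Rightarrow> 'a::euclidean_space set \<Rightarrow> 'a set \<Rightarrow> 'a set" where
  "mink_comb r s K L = (\<lambda>x. r *\<^sub>R x) ` K + (\<lambda>x. s *\<^sub>R x) ` L"

lemma mink_comb_iff: "z \<in> mink_comb r s K L \<longleftrightarrow> (\<exists>x\<in>K. \<exists>y\<in>L. z = r *\<^sub>R x + s *\<^sub>R y)"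
  unfolding mink_comb_def set_plus_def by auto

lemma convex_mink_comb: "convex K \<Longrightarrow> convex L \<Longrightarrow> convex (mink_comb r s K L)"
  unfolding mink_comb_def by (intro convex_set_plus convex_scaling)

lemma compact_mink_comb: "compact K \<Longrightarrow> compact L \<Longrightarrow> compact (mink_comb r s K L)"
proof -
  assume "compact K" "compact L"
  then have "compact {x + y |x y. x \<in> (\<lambda>x. r *\<^sub>R x) ` K \<and> y \<in> (\<lambda>x. s *\<^sub>R x) ` L}"
    by (intro compact_sums compact_scaling)
  also have "\<dots> = mink_comb r s K L"
    unfolding mink_comb_def set_plus_def by blast
  finally show "compact (mink_comb r s K L)" .
qed

definition grad_comb where "grad_comb r s P Q x = r *\<^sub>R grad_lse P x + s *\<^sub>R grad_lse Q x"
definition hess_comb where "hess_comb r s P Q x v = r *\<^sub>R hess_lse P x v + s *\<^sub>R hess_lse Q x v"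

context
  fixes P Q :: "'a::euclidean_space set" and r s :: real
  assumes P: "finite P" "P \<noteq> {}" and Q: "finite Q" "Q \<noteq> {}" and rs: "r \<ge> 0" "s \<ge> 0"
begin

lemma grad_comb_has_derivative: 
  "(grad_comb r s P Q has_derivative hess_comb r s P Q x) (at x)"
proof -
  have "((\<lambda>x. r *\<^sub>R grad_lse P x + s *\<^sub>R grad_lse Q x) has_derivative (\<lambda>v. r *\<^sub>R hess_lse P x v + s *\<^sub>R hess_lse Q x v)) (at x)"
    by (intro derivative_intros grad_lse_has_derivative P Q)
  then show ?thesis by (simp add: grad_comb_def[abs_def] hess_comb_def[abs_def])
qed

lemma linear_hess_comb: "linear (hess_comb r s P Q x)"
  by (rule has_derivative_linear[OF grad_comb_has_derivative])

lemma grad_comb_in: "grad_comb r s P Q x \<in> mink_comb r s (convex hull P) (convex hull Q)"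
  unfolding mink_comb_iff grad_comb_def using grad_lse_in_hull[OF P] grad_lse_in_hull[OF Q] by blast

lemma inner_hess_comb_nonneg: "v \<bullet> hess_comb r s P Q x v \<ge> 0"
  unfolding hess_comb_def inner_add_right inner_scaleR_right 
  by (intro add_nonneg_nonneg mult_nonneg_nonneg rs inner_hess_lse_nonneg P Q)

lemma mink_comb_hull_subset_hyperplane:
  assumes "\<And>p q. p \<in> P \<Longrightarrow> q \<in> Q \<Longrightarrow> v \<bullet> (r *\<^sub>R p + s *\<^sub>R q) = b"
  shows "mink_comb r s (convex hull P) (convex hull Q) \<subseteq> {x. v \<bullet> x = b}"
proof -
  \<comment> \<open>The hulls are taken one argument at a time. The functional is multiplied by
    \<open>r\<close>, and later by \<open>s\<close>, so that no division is made and zero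
    coefficients are covered.\<close>
  have "convex hull P \<subseteq> {p. (r *\<^sub>R v) \<bullet> p = b - s * (v \<bullet> q)}" if "q \<in> Q" for q
    using assms that by (intro hull_minimal convex_hyperplane) (auto simp: inner_add_right algebra_simps)
  then have 1: "v \<bullet> (r *\<^sub>R p + s *\<^sub>R q) = b" if "p \<in> convex hull P" "q \<in> Q" for p q
    using that by (auto simp: inner_add_right algebra_simps)
  have "convex hull Q \<subseteq> {q. (s *\<^sub>R v) \<bullet> q = b - r * (v \<bullet> p)}" if "p \<in> convex hull P" for p
    using 1 that by (intro hull_minimal convex_hyperplane) (auto simp: inner_add_right algebra_simps)
  then have "v \<bullet> (r *\<^sub>R p + s *\<^sub>R q) = b" if "p \<in> convex hull P" "q \<in> convex hull Q" for p q
    using that by (auto simp: inner_add_right algebra_simps)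
  then show ?thesis by (auto simp: mink_comb_iff)
qed

text \<open>If two points have equal images, the mean value theorem on the segment between them
  gives a point where the Hessian form vanishes in the direction \<open>v\<close> of the segment.
  Zero variance in that direction puts the whole combination into a hyperplane orthogonal to
  \<open>v\<close>, so its interior is empty.\<close>

lemma inj_grad_comb:
  assumes "interior (mink_comb r s (convex hull P) (convex hull Q)) \<noteq> {}"
  shows "inj (grad_comb r s P Q)"
proof (rule injI, rule ccontr)
  fix x x' assume eq: "grad_comb r s P Q x = grad_comb r s P Q x'" and ne: "x \<noteq> x'"
  define v where "v = x' - x"
  define h where "h t = v \<bullet> grad_comb r s P Q (x + t *\<^sub>R v)" for t
  have "(h has_derivative (\<lambda>u. v \<bullet> hess_comb r s P Q (x + t *\<^sub>R v) (u *\<^sub>R v))) (at t)" for t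
    unfolding h_def
    by (rule derivative_eq_intros has_derivative_compose[OF _ grad_comb_has_derivative] refl | simp)+
  moreover have "h 1 = h 0" by (simp add: h_def eq v_def)
  ultimately obtain t where "h 1 - h 0 = v \<bullet> hess_comb r s P Q (x + t *\<^sub>R v) ((1 - 0) *\<^sub>R v)"
    using mvt_simple[of 0 1 h "\<lambda>t u. v \<bullet> hess_comb r s P Q (x + t *\<^sub>R v) (u *\<^sub>R v)"]
    by (auto intro: has_derivative_at_withinI)
  with \<open>h 1 = h 0\<close> have t: "v \<bullet> hess_comb r s P Q (x + t *\<^sub>R v) v = 0"
    by simp
  let ?y = "x + t *\<^sub>R v"
  have "r * (v \<bullet> hess_lse P ?y v) + s * (v \<bullet> hess_lse Q ?y v) = 0"
    using t by (simp add: hess_comb_def inner_add_right)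
  moreover have "r * (v \<bullet> hess_lse P ?y v) \<ge> 0" "s * (v \<bullet> hess_lse Q ?y v) \<ge> 0"
    using inner_hess_lse_nonneg[OF P] inner_hess_lse_nonneg[OF Q] rs by auto
  ultimately have "r * (v \<bullet> hess_lse P ?y v) = 0" "s * (v \<bullet> hess_lse Q ?y v) = 0"
    by linarith+
  then have *: "r = 0 \<or> v \<bullet> hess_lse P ?y v = 0" "s = 0 \<or> v \<bullet> hess_lse Q ?y v = 0" by simp_all
  have "v \<bullet> (r *\<^sub>R p + s *\<^sub>R q) = r * (grad_lse P ?y \<bullet> v) + s * (grad_lse Q ?y \<bullet> v)" if "p \<in> P" "q \<in> Q" for p q
    using * inner_hess_lse_eq_0[OF P _ that(1), of v ?y] inner_hess_lse_eq_0[OF Q _ that(2), of v ?y]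
    by (auto simp: inner_add_right inner_commute)
  then have "mink_comb r s (convex hull P) (convex hull Q) \<subseteq> {z. v \<bullet> z = r * (grad_lse P ?y \<bullet> v) + s * (grad_lse Q ?y \<bullet> v)}"
    by (rule mink_comb_hull_subset_hyperplane)
  moreover have "v \<noteq> 0" using ne by (simp add: v_def)
  ultimately have "interior (mink_comb r s (convex hull P) (convex hull Q)) = {}"
    by (metis interior_hyperplane interior_mono subset_empty)
  with assms show False by simp
qed

lemma interior_subset_range_grad_comb:
  "interior (mink_comb r s (convex hull P) (convex hull Q)) \<subseteq> range (grad_comb r s P Q)"
proof
  fix y assume "y \<in> interior (mink_comb r s (convex hull P) (convex hull Q))"
  then obtain d where d: "d > 0" "cball y d \<subseteq> mink_comb r s (convex hull P) (convex hull Q)"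
    using mem_interior_cball by blast
  \<comment> \<open>A critical point of this coercive function is a preimage of \<open>y\<close>.\<close>
  define f where "f x = r * lse P x + s * lse Q x - y \<bullet> x" for x
  have df: "(f has_derivative (\<lambda>v. (grad_comb r s P Q x - y) \<bullet> v)) (at x)" for x
    unfolding f_def grad_comb_def
    by (rule derivative_eq_intros lse_has_derivative P Q refl | simp)+ (simp add: inner_diff_left inner_add_left)
  \<comment> \<open>The sum of the \<open>lse\<close> terms dominates the support function of the
    combination, which contains the point at distance \<open>d\<close> from \<open>y\<close> in the
    direction of \<open>x\<close>.\<close>
  have ge: "d * norm x \<le> f x" for x
  proof -
    have "n \<bullet> x \<le> r * lse P x + s * lse Q x" if n: "n \<in> mink_comb r s (convex hull P) (convex hull Q)" for n
    proof -
      from n obtain p q where pq: "p \<in> convex hull P" "q \<in> convex hull Q" "n = r *\<^sub>R p + s *\<^sub>R q"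
        by (auto simp: mink_comb_iff)
      show ?thesis
        using mult_left_mono[OF lse_ge[OF P(1) pq(1)] rs(1), of x] mult_left_mono[OF lse_ge[OF Q(1) pq(2)] rs(2), of x]
        by (simp add: pq inner_add_left)
    qed
    moreover have "y + d *\<^sub>R sgn x \<in> mink_comb r s (convex hull P) (convex hull Q)"
      using d by (intro subsetD[OF d(2)]) (auto simp: dist_norm norm_sgn)
    ultimately have "(y + d *\<^sub>R sgn x) \<bullet> x \<le> r * lse P x + s * lse Q x" by blast
    moreover have "sgn x \<bullet> x = norm x"
      by (cases "x = 0") (simp_all add: sgn_div_norm dot_square_norm power2_eq_square)
    ultimately show ?thesis by (simp add: f_def inner_add_left)
  qed
  \<comment> \<open>Outside the ball of radius \<open>R\<close> the bound \<open>ge\<close> makes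
    \<open>f\<close> larger than \<open>f 0\<close>, so a minimum over the ball is a global
    one.\<close>
  define R where "R = \<bar>f 0\<bar> / d"
  have "continuous_on (cball 0 R) f"
    using df by (meson has_derivative_continuous continuous_at_imp_continuous_on)
  moreover have "cball (0::'a) R \<noteq> {}" using d by (simp add: R_def cball_eq_empty not_less)
  ultimately obtain x where x: "x \<in> cball 0 R" "\<And>z. z \<in> cball 0 R \<Longrightarrow> f x \<le> f z"
    using continuous_attains_inf[of "cball 0 R" f] by auto
  have "f x \<le> f z" for z
  proof (cases "z \<in> cball 0 R")
    case False
    then have "d * norm z > \<bar>f 0\<bar>" using d by (simp add: R_def field_simps)
    moreover have "f x \<le> f 0" using d by (intro x(2)) (simp add: R_def)
    ultimately show ?thesis using ge[of z] by linarith
  qed (use x in auto)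
  then have "(\<lambda>v. (grad_comb r s P Q x - y) \<bullet> v) = (\<lambda>v. 0)"
    by (intro differential_zero_maxmin[of x UNIV f]) (use df in auto)
  then have "grad_comb r s P Q x = y"
    by (metis inner_eq_zero_iff right_minus_eq)
  then show "y \<in> range (grad_comb r s P Q)" by auto
qed

end

subsection \<open>Polynomiality of the volume of Minkowski combinations\<close>

lemma det_nonneg_if_psd:
  fixes A :: "real^'n^'n"
  assumes "\<And>v. v \<bullet> (A *v v) \<ge> 0"
  shows "det A \<ge> 0"
proof (rule ccontr)
  assume neg: "\<not> det A \<ge> 0"
  \<comment> \<open>The segment from the identity to \<open>A\<close> stays invertible before it reaches \<open>A\<close>.\<close>
  define B where "B t = (1 - t) *\<^sub>R mat 1 + t *\<^sub>R A" for t :: real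
  have "continuous_on {0..1} (\<lambda>t. det (B t))"
    unfolding B_def det_def by (intro continuous_intros)
  moreover have "det (B 0) = 1" "det (B 1) = det A" by (simp_all add: B_def)
  ultimately obtain t where t: "0 \<le> t" "t \<le> 1" "det (B t) = 0"
    using IVT2'[of "\<lambda>t. det (B t)" 1 0 0] neg by auto
  then have "t \<noteq> 1" using neg \<open>det (B 1) = det A\<close> by auto
  have "\<not> invertible (B t)" using t by (simp add: invertible_det_nz)
  then obtain v where v: "v \<noteq> 0" "B t *v v = 0"
    by (metis invertible_left_inverse matrix_left_invertible_ker)
  then have "0 = v \<bullet> (B t *v v)" by simp
  also have "\<dots> = (1 - t) * (v \<bullet> v) + t * (v \<bullet> (A *v v))"
    by (simp add: B_def matrix_vector_mult_add_rdistrib scaleR_matrix_vector_assoc[symmetric] inner_add_right)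
  also have "\<dots> > 0"
    using t \<open>t \<noteq> 1\<close> v(1) assms[of v] by (intro add_pos_nonneg) auto
  finally show False by simp
qed

text \<open>An invertible matrix would have \<open>a\<close> itself in its range, making
  \<open>a\<close> orthogonal to itself.\<close>

lemma det_eq_0_if_range_orthogonal:
  fixes A :: "real^'n^'n"
  assumes "a \<noteq> 0" "\<And>v. a \<bullet> (A *v v) = 0"
  shows "det A = 0"
proof (rule ccontr)
  assume "det A \<noteq> 0"
  then obtain B where "A ** B = mat 1"
    using invertible_det_nz invertible_def by blast
  then have "A *v (B *v a) = a" by (simp add: matrix_vector_mul_assoc)
  with assms show False by (metis inner_eq_zero_iff)
qed

text \<open>Change of variables along the gradient map. If the combination is flat, the map stays in
  a hyperplane and its Jacobian vanishes, as does the volume. Otherwise the map is injective and its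
  range lies between the interior and the whole combination, which differ by a null set; the
  Jacobian needs no absolute value because the Hessian form is nonnegative.\<close>

theorem has_integral_measure_mink_comb:
  fixes P Q :: "(real^'n::{finite,wellorder}) set"
  assumes P: "finite P" "P \<noteq> {}" and Q: "finite Q" "Q \<noteq> {}" and rs: "r \<ge> 0" "s \<ge> 0"
  shows "((\<lambda>x. det (matrix (hess_comb r s P Q x))) has_integral
            measure lebesgue (mink_comb r s (convex hull P) (convex hull Q))) UNIV"
proof -
  let ?N = "mink_comb r s (convex hull P) (convex hull Q)"
  let ?G = "grad_comb r s P Q" and ?H = "hess_comb r s P Q"
  have mat: "matrix (?H x) *v v = ?H x v" for x v
    by (rule matrix_works) (simp only: linear_matrix_vector_mul_eq linear_hess_comb[OF P Q rs])
  have cvx: "convex ?N" by (intro convex_mink_comb convex_convex_hull)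
  show ?thesis
  proof (cases "interior ?N = {}")
    case True
    from empty_interior_subset_hyperplane[OF cvx True] obtain a b where ab: "a \<noteq> 0" "?N \<subseteq> {x. a \<bullet> x = b}" .
    have "det (matrix (?H x)) = 0" for x
    proof (rule det_eq_0_if_range_orthogonal[OF ab(1)], unfold mat)
      have "(\<lambda>x. a \<bullet> ?G x) = (\<lambda>x. b)"
        using grad_comb_in[OF P Q rs] ab(2) by auto
      moreover have "((\<lambda>x. a \<bullet> ?G x) has_derivative (\<lambda>v. a \<bullet> ?H x v)) (at x)"
        by (intro derivative_intros grad_comb_has_derivative P Q rs)
      ultimately have "((\<lambda>x. b) has_derivative (\<lambda>v. a \<bullet> ?H x v)) (at x)" by simp
      then have "(\<lambda>v. a \<bullet> ?H x v) = (\<lambda>v. 0)"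
        using has_derivative_unique has_derivative_const by blast
      then show "a \<bullet> ?H x v = 0" for v by metis
    qed
    moreover have "measure lebesgue ?N = 0"
      using negligible_convex_interior[OF cvx] True negligible_imp_measure0 by blast
    ultimately show ?thesis by simp
  next
    case False
    have sub: "interior ?N \<subseteq> range ?G" "range ?G \<subseteq> ?N"
      using interior_subset_range_grad_comb[OF P Q rs] grad_comb_in[OF P Q rs] by auto
    have comp: "compact ?N" by (intro compact_mink_comb finite_imp_compact_convex_hull P Q)
    have "frontier ?N = ?N - interior ?N"
      using comp by (simp add: compact_imp_closed frontier_def)
    then have "negligible (?N - interior ?N)"
      using negligible_convex_frontier[OF cvx] by simp
    then have neg: "negligible ((?N - range ?G) \<union> (range ?G - ?N))"
      by (rule negligible_subset) (use sub in auto)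
    have "range ?G \<in> lmeasurable" "measure lebesgue (range ?G) = measure lebesgue ?N"
      using lmeasurable_negligible_symdiff[OF lmeasurable_compact[OF comp] neg]
        measure_negligible_symdiff[OF lmeasurable_compact[OF comp] neg] by auto
    then have "((\<lambda>x. \<bar>det (matrix (?H x))\<bar>) has_integral measure lebesgue ?N) UNIV"
      using has_measure_differentiable_image[of UNIV ?G ?H "measure lebesgue ?N"]
        grad_comb_has_derivative[OF P Q rs] inj_grad_comb[OF P Q rs False] by auto
    moreover have "det (matrix (?H x)) \<ge> 0" for x
      by (rule det_nonneg_if_psd) (simp add: mat inner_hess_comb_nonneg[OF P Q rs])
    ultimately show ?thesis by simp
  qed
qed

section \<open>Lagrange interpolation at integer nodes\<close>

definition lagrange_basis :: "nat \<Rightarrow> nat \<Rightarrow> real poly" where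
  "lagrange_basis n i = (\<Prod>j\<in>{..n}-{i}. smult (1 / (real i - real j)) [:- real j, 1:])"

lemma degree_lagrange_basis: "i \<le> n \<Longrightarrow> degree (lagrange_basis n i) \<le> n"
proof -
  assume "i \<le> n"
  have "degree (lagrange_basis n i) \<le> sum (degree \<circ> (\<lambda>j. smult (1 / (real i - real j)) [:- real j, 1:])) ({..n}-{i})"
    unfolding lagrange_basis_def by (rule degree_prod_sum_le) simp
  also have "\<dots> \<le> sum (\<lambda>j. 1) ({..n}-{i})"
    by (intro sum_mono) (auto simp: o_def)
  also have "\<dots> = n" using \<open>i \<le> n\<close> by simp
  finally show ?thesis .
qed

lemma poly_lagrange_basis:
  assumes "i \<le> n" "k \<le> n"
  shows "poly (lagrange_basis n i) (real k) = (if k = i then 1 else 0)"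
proof (cases "k = i")
  case True
  then show ?thesis
    by (auto simp: lagrange_basis_def poly_prod diff_divide_distrib[symmetric] intro!: prod.neutral)
next
  case False
  then show ?thesis
    using assms by (auto simp: lagrange_basis_def poly_prod prod_zero_iff)
qed

text \<open>Both sides have degree at most \<open>n\<close> and agree at the \<open>n + 1\<close>
  nodes.\<close>

lemma lagrange_interpolation:
  fixes p :: "real poly"
  assumes "degree p \<le> n"
  shows "poly p x = (\<Sum>i\<le>n. poly p (real i) * poly (lagrange_basis n i) x)"
proof -
  have "p = (\<Sum>i\<le>n. smult (poly p (real i)) (lagrange_basis n i))" (is "_ = ?q")
  proof (rule poly_eqI_degree)
    show "poly p x = poly ?q x" if "x \<in> real ` {..n}" for x
      using that by (auto simp: poly_sum poly_lagrange_basis if_distrib cong: if_cong)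
    show "degree p < card (real ` {..n})"
      using assms by (simp add: card_image)
    have "degree ?q \<le> n"
      by (intro degree_sum_le) (auto intro: order.trans[OF degree_smult_le] degree_lagrange_basis)
    then show "degree ?q < card (real ` {..n})"
      by (simp add: card_image)
  qed
  then have "poly p x = poly ?q x" by simp
  then show ?thesis by (simp add: poly_sum)
qed

text \<open>In the Leibniz formula every permutation contributes a product of
  \<open>CARD('n)\<close> factors that are affine in \<open>t\<close>.\<close>

lemma det_linear_pencil_poly:
  fixes A B :: "real^'n^'n"
  obtains p where "degree p \<le> CARD('n)" "\<And>t. det (A + t *\<^sub>R B) = poly p t"
proof
  define M where "M \<pi> = smult (of_int (sign \<pi>)) (\<Prod>i\<in>UNIV. [:A$i$\<pi> i, B$i$\<pi> i:])" for \<pi> :: "'n \<Rightarrow> 'n"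
  let ?p = "\<Sum>\<pi> | \<pi> permutes UNIV. M \<pi>"
  show "det (A + t *\<^sub>R B) = poly ?p t" for t
    by (simp add: det_def M_def poly_sum poly_prod)
  show "degree ?p \<le> CARD('n)"
  proof (intro degree_sum_le)
    fix \<pi>
    have "degree (M \<pi>) \<le> degree (\<Prod>i\<in>UNIV. [:A$i$\<pi> i, B$i$\<pi> i:])"
      unfolding M_def by (rule degree_smult_le)
    also have "\<dots> \<le> sum (degree \<circ> (\<lambda>i. [:A$i$\<pi> i, B$i$\<pi> i:])) UNIV"
      by (rule degree_prod_sum_le) simp
    also have "\<dots> \<le> sum (\<lambda>i. 1) (UNIV::'n set)"
      by (intro sum_mono) simp
    finally show "degree (M \<pi>) \<le> CARD('n)" by simp
  qed simp
qed

text \<open>Interpolation first in \<open>r\<close> with \<open>s\<close> fixed, then in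
  \<open>s\<close> at each node. The matrices then enter only through determinants at integer nodes,
  which can be integrated separately.\<close>

lemma det_comb_interpolation:
  fixes A B :: "real^'n^'n"
  defines "n \<equiv> CARD('n)"
  shows "det (r *\<^sub>R A + s *\<^sub>R B) = (\<Sum>i\<le>n. \<Sum>j\<le>n. det (real i *\<^sub>R A + real j *\<^sub>R B)
            * poly (lagrange_basis n i) r * poly (lagrange_basis n j) s)"
proof -
  obtain p where p: "degree p \<le> n" "\<And>t. det (s *\<^sub>R B + t *\<^sub>R A) = poly p t"
    using det_linear_pencil_poly[of "s *\<^sub>R B" A] unfolding n_def by blast
  have "det (r *\<^sub>R A + s *\<^sub>R B) = (\<Sum>i\<le>n. det (real i *\<^sub>R A + s *\<^sub>R B) * poly (lagrange_basis n i) r)"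
    using lagrange_interpolation[OF p(1), of r] unfolding p(2)[symmetric] by (simp add: add.commute)
  also have "\<dots> = (\<Sum>i\<le>n. (\<Sum>j\<le>n. det (real i *\<^sub>R A + real j *\<^sub>R B) * poly (lagrange_basis n j) s) * poly (lagrange_basis n i) r)"
  proof (intro sum.cong refl arg_cong2[of _ _ _ _ "(*)"])
    fix i
    obtain q where q: "degree q \<le> n" "\<And>t. det (real i *\<^sub>R A + t *\<^sub>R B) = poly q t"
      using det_linear_pencil_poly[of "real i *\<^sub>R A" B] unfolding n_def by blast
    show "det (real i *\<^sub>R A + s *\<^sub>R B) = (\<Sum>j\<le>n. det (real i *\<^sub>R A + real j *\<^sub>R B) * poly (lagrange_basis n j) s)"
      using lagrange_interpolation[OF q(1), of s] q(2) by simp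
  qed
  finally show ?thesis by (simp add: sum_distrib_left mult_ac)
qed

text \<open>
  Polynomiality is expressed as invariance under interpolation at the integers up to \<open>n\<close>, because this
  identity is preserved both by integration and by pointwise limits.
\<close>
definition mink_poly :: "(real \<Rightarrow> real \<Rightarrow> real) \<Rightarrow> nat \<Rightarrow> real \<Rightarrow> real \<Rightarrow> real" where
  "mink_poly V n r s = (\<Sum>i\<le>n. \<Sum>j\<le>n. V (real i) (real j) * poly (lagrange_basis n i) r * poly (lagrange_basis n j) s)"

text \<open>The volume is the integral of a determinant satisfying the interpolation identity
  pointwise. The nodes are nonnegative, so the integral formula applies at each of them and the
  identity passes to the integrals.\<close>

lemma measure_mink_comb_hull:
  fixes P Q :: "(real^'n::{finite,wellorder}) set"
  assumes P: "finite P" "P \<noteq> {}" and Q: "finite Q" "Q \<noteq> {}" and rs: "r \<ge> 0" "s \<ge> 0"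
  defines "V \<equiv> \<lambda>r s. measure lebesgue (mink_comb r s (convex hull P) (convex hull Q))"
  shows "V r s = mink_poly V CARD('n) r s"
proof -
  let ?n = "CARD('n)"
  let ?A = "\<lambda>x. matrix (hess_lse P x)" and ?B = "\<lambda>x. matrix (hess_lse Q x)"
  have mat: "matrix (hess_comb r s P Q x) = r *\<^sub>R ?A x + s *\<^sub>R ?B x" for r s x
    by (simp add: vec_eq_iff matrix_def hess_comb_def)
  have int: "((\<lambda>x. det (r *\<^sub>R ?A x + s *\<^sub>R ?B x)) has_integral V r s) UNIV" if "r \<ge> 0" "s \<ge> 0" for r s
    using has_integral_measure_mink_comb[OF P Q that] unfolding mat V_def .
  have "((\<lambda>x. \<Sum>i\<le>?n. \<Sum>j\<le>?n. det (real i *\<^sub>R ?A x + real j *\<^sub>R ?B x)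
            * poly (lagrange_basis ?n i) r * poly (lagrange_basis ?n j) s) has_integral
          mink_poly V ?n r s) UNIV"
    unfolding mink_poly_def
    by (intro has_integral_sum has_integral_mult_left int finite_atMost of_nat_0_le_iff)
  then have "((\<lambda>x. det (r *\<^sub>R ?A x + s *\<^sub>R ?B x)) has_integral mink_poly V ?n r s) UNIV"
    by (simp only: det_comb_interpolation[of r _ s, symmetric])
  with int[OF rs] show ?thesis by (rule has_integral_unique)
qed

section \<open>From finite point sets to compact convex bodies\<close>

lemma dense_increasing_finite_subsets:
  fixes K :: "'a::euclidean_space set"
  assumes "K \<noteq> {}"
  obtains F where "\<And>k::nat. finite (F k)" "\<And>k. F k \<noteq> {}" "\<And>k. F k \<subseteq> K" "incseq F" "K \<subseteq> closure (\<Union>k. F k)"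
proof -
  obtain T where T: "countable T" "T \<subseteq> K" "K \<subseteq> closure T" using separable .
  then have "T \<noteq> {}" using assms by auto
  show ?thesis
  proof
    \<comment> \<open>Initial segments of an enumeration of a countable dense subset; the
      enumeration repeats points if that subset is finite.\<close>
    let ?F = "\<lambda>k. from_nat_into T ` {..k}"
    show "?F k \<subseteq> K" for k using T(2) from_nat_into[OF \<open>T \<noteq> {}\<close>] by auto
    show "incseq ?F" by (auto simp: incseq_def)
    have "(\<Union>k. ?F k) = range (from_nat_into T)" by auto
    also have "\<dots> = T" using range_from_nat_into[OF \<open>T \<noteq> {}\<close> T(1)] .
    finally show "K \<subseteq> closure (\<Union>k. ?F k)" using T(3) by simp
  qed auto
qed

lemma mink_comb_mono: "K \<subseteq> K' \<Longrightarrow> L \<subseteq> L' \<Longrightarrow> mink_comb r s K L \<subseteq> mink_comb r s K' L'"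
  unfolding subset_iff mink_comb_iff by blast

lemma mink_comb_closure_subset: "mink_comb r s (closure K) (closure L) \<subseteq> closure (mink_comb r s K L)"
proof
  fix z assume "z \<in> mink_comb r s (closure K) (closure L)"
  then obtain x y where xy: "x \<in> closure K" "y \<in> closure L" "z = r *\<^sub>R x + s *\<^sub>R y"
    by (auto simp: mink_comb_iff)
  then obtain f g where fg: "\<And>n. f n \<in> K" "f \<longlonglongrightarrow> x" "\<And>n. g n \<in> L" "g \<longlonglongrightarrow> y"
    unfolding closure_sequential by blast
  have "(\<lambda>n. r *\<^sub>R f n + s *\<^sub>R g n) \<longlonglongrightarrow> z"
    unfolding xy by (intro tendsto_intros fg)
  moreover have "r *\<^sub>R f n + s *\<^sub>R g n \<in> mink_comb r s K L" for n
    using fg by (auto simp: mink_comb_iff)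
  ultimately show "z \<in> closure (mink_comb r s K L)"
    unfolding closure_sequential by (intro exI[of _ "\<lambda>n. r *\<^sub>R f n + s *\<^sub>R g n"]) simp
qed

text \<open>The approximating volumes increase to that of the union \<open>?U\<close>. This union is
  convex and dense in the limit body, so what is missing lies in the frontier of a convex set and is
  negligible.\<close>

lemma measure_mink_comb_limit:
  fixes K L :: "'a::euclidean_space set"
  assumes K: "compact K" "convex K" and L: "compact L" "convex L"
    and F: "\<And>k. F k \<subseteq> K" "incseq F" "K \<subseteq> closure (\<Union>k. F k)"
    and G: "\<And>k. G k \<subseteq> L" "incseq G" "L \<subseteq> closure (\<Union>k. G k)"
    and fin: "\<And>k. finite (F k)" "\<And>k. finite (G k)"
  shows "(\<lambda>k. measure lebesgue (mink_comb r s (convex hull F k) (convex hull G k)))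
            \<longlonglongrightarrow> measure lebesgue (mink_comb r s K L)"
proof -
  let ?M = "\<lambda>k. mink_comb r s (convex hull F k) (convex hull G k)" and ?N = "mink_comb r s K L"
  have sub: "?M k \<subseteq> ?N" for k
    by (intro mink_comb_mono hull_minimal F G K L)
  have mono: "?M k \<subseteq> ?M l" if "k \<le> l" for k l
    using that F(2) G(2) by (intro mink_comb_mono hull_mono) (auto simp: incseq_def)
  have cvx: "convex (?M k)" for k by (intro convex_mink_comb convex_convex_hull)
  have M: "?M k \<in> lmeasurable" for k
    by (intro lmeasurable_compact compact_mink_comb finite_imp_compact_convex_hull fin)
  have N: "?N \<in> lmeasurable" "compact ?N" using K L by (auto intro!: lmeasurable_compact compact_mink_comb)
  have lim: "(\<lambda>k. measure lebesgue (?M k)) \<longlonglongrightarrow> measure lebesgue (\<Union>k. ?M k)"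
    by (rule measure_nested_Union[of _ "measure lebesgue ?N"])
      (use M N sub mono in \<open>auto intro!: measure_mono_fmeasurable\<close>)
  let ?U = "\<Union>k. ?M k"
  have cU: "convex ?U"
  proof (rule convexI)
    fix x y and u v :: real assume "x \<in> ?U" "y \<in> ?U" and uv: "0 \<le> u" "0 \<le> v" "u + v = 1"
    then obtain k l where "x \<in> ?M k" "y \<in> ?M l" by blast
    then have "x \<in> ?M (max k l)" "y \<in> ?M (max k l)"
      using mono[of k "max k l"] mono[of l "max k l"] by auto
    then have "u *\<^sub>R x + v *\<^sub>R y \<in> ?M (max k l)" using cvx uv convexD by blast
    then show "u *\<^sub>R x + v *\<^sub>R y \<in> ?U" by blast
  qed
  have "mink_comb r s (\<Union>k. F k) (\<Union>k. G k) \<subseteq> ?U"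
  proof
    fix z assume "z \<in> mink_comb r s (\<Union>k. F k) (\<Union>k. G k)"
    then obtain x y k l where xy: "x \<in> F k" "y \<in> G l" and z: "z = r *\<^sub>R x + s *\<^sub>R y"
      by (auto simp: mink_comb_iff)
    have "F k \<subseteq> F (max k l)" "G l \<subseteq> G (max k l)"
      using F(2) G(2) by (simp_all add: incseq_def)
    with xy have "x \<in> convex hull F (max k l)" "y \<in> convex hull G (max k l)"
      by (auto intro!: hull_inc)
    then have "z \<in> ?M (max k l)" unfolding mink_comb_iff z by blast
    then show "z \<in> ?U" by blast
  qed
  then have "?N \<subseteq> closure ?U"
    using mink_comb_mono[OF F(3) G(3), of r s] mink_comb_closure_subset closure_mono by blast
  then have "(?N - ?U) \<union> (?U - ?N) \<subseteq> frontier ?U"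
    using sub interior_subset[of ?U] unfolding frontier_def by blast
  then have neg: "negligible ((?N - ?U) \<union> (?U - ?N))"
    by (rule negligible_subset[OF negligible_convex_frontier[OF cU]])
  then have "measure lebesgue ?U = measure lebesgue ?N"
    by (rule measure_negligible_symdiff[OF N(1)])
  with lim show ?thesis by simp
qed

text \<open>\<open>mink_poly\<close> is a finite combination of volumes at fixed nodes, so both
  sides of the identity for hulls of finite sets converge.\<close>

lemma measure_mink_comb_wellorder:
  fixes K L :: "(real^'n::{finite,wellorder}) set"
  assumes K: "compact K" "convex K" "K \<noteq> {}" and L: "compact L" "convex L" "L \<noteq> {}" and rs: "r \<ge> 0" "s \<ge> 0"
  shows "measure lebesgue (mink_comb r s K L) = mink_poly (\<lambda>r s. measure lebesgue (mink_comb r s K L)) CARD('n) r s"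
proof -
  obtain F where F: "\<And>k::nat. finite (F k)" "\<And>k. F k \<noteq> {}" "\<And>k. F k \<subseteq> K" "incseq F" "K \<subseteq> closure (\<Union>k. F k)"
    by (rule dense_increasing_finite_subsets[OF K(3)]) blast
  obtain G where G: "\<And>k::nat. finite (G k)" "\<And>k. G k \<noteq> {}" "\<And>k. G k \<subseteq> L" "incseq G" "L \<subseteq> closure (\<Union>k. G k)"
    by (rule dense_increasing_finite_subsets[OF L(3)]) blast
  let ?V = "\<lambda>k r s. measure lebesgue (mink_comb r s (convex hull F k) (convex hull G k))"
  have lim: "(\<lambda>k. ?V k r s) \<longlonglongrightarrow> measure lebesgue (mink_comb r s K L)" for r s
    by (intro measure_mink_comb_limit K L F G)
  have "(\<lambda>k. mink_poly (?V k) CARD('n) r s) \<longlonglongrightarrow> mink_poly (\<lambda>r s. measure lebesgue (mink_comb r s K L)) CARD('n) r s"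
    unfolding mink_poly_def by (intro tendsto_intros lim)
  then have "(\<lambda>k. ?V k r s) \<longlonglongrightarrow> mink_poly (\<lambda>r s. measure lebesgue (mink_comb r s K L)) CARD('n) r s"
    unfolding measure_mink_comb_hull[OF F(1,2) G(1,2) rs, symmetric] .
  with lim show ?thesis by (rule LIMSEQ_unique)
qed

text \<open>
  The change of variables theorem of the library needs a well-ordered index type; a copy of the index
  type carries such an order.
\<close>
typedef 'n enumerated = "UNIV :: 'n set" morphisms unenum enum ..

instance enumerated :: (finite) finite
proof
  have "range (enum :: 'a \<Rightarrow> 'a enumerated) = UNIV"
    by (metis enum_cases surj_def)
  then show "finite (UNIV :: 'a enumerated set)" by (metis finite finite_imageI)
qed

instantiation enumerated :: (finite) wellorder
begin
definition less_eq_enumerated :: "'a enumerated \<Rightarrow> 'a enumerated \<Rightarrow> bool" where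
  "less_eq_enumerated x y \<longleftrightarrow> to_nat (unenum x) \<le> to_nat (unenum y)"
definition less_enumerated :: "'a enumerated \<Rightarrow> 'a enumerated \<Rightarrow> bool" where
  "less_enumerated x y \<longleftrightarrow> to_nat (unenum x) < to_nat (unenum y)"
instance
proof
  fix x y z :: "'a enumerated"
  show "x < y \<longleftrightarrow> x \<le> y \<and> \<not> y \<le> x" "x \<le> x" "x \<le> y \<or> y \<le> x"
    by (auto simp: less_eq_enumerated_def less_enumerated_def)
  show "x \<le> z" if "x \<le> y" "y \<le> z" using that by (simp add: less_eq_enumerated_def)
  show "x = y" if "x \<le> y" "y \<le> x"
    using that by (simp add: less_eq_enumerated_def unenum_inject)
next
  fix P and a :: "'a enumerated"
  assume step: "\<And>x::'a enumerated. (\<And>y. y < x \<Longrightarrow> P y) \<Longrightarrow> P x"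
  show "P a"
    by (rule measure_induct_rule[of "\<lambda>x. to_nat (unenum x)"]) (use step in \<open>auto simp: less_enumerated_def\<close>)
qed
end

section \<open>Transport of volume along a relabelling of coordinates\<close>

definition relabel :: "real^'n \<Rightarrow> real^('n enumerated)" where
  "relabel x = (\<chi> i. x $ unenum i)"

lemma bij_unenum: "bij unenum"
  by (rule bij_betw_byWitness[of _ enum]) (auto simp: enum_inverse unenum_inverse)

lemma card_enumerated: "CARD('n enumerated) = CARD('n)"
  using bij_betw_same_card[OF bij_unenum[where 'a='n]] .

lemma linear_relabel: "linear relabel"
  by (rule linearI) (simp_all add: relabel_def vec_eq_iff)

lemma inj_relabel: "inj (relabel :: real^'n \<Rightarrow> _)"
proof (rule injI)
  fix x y :: "real^'n" assume *: "relabel x = relabel y"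
  have "x $ i = y $ i" for i
    using arg_cong[OF *, of "\<lambda>z. z $ enum i"] by (simp add: relabel_def enum_inverse)
  then show "x = y" by (simp add: vec_eq_iff)
qed

lemma continuous_on_relabel: "continuous_on S relabel"
  by (rule linear_continuous_on) (use linear_relabel in \<open>simp add: linear_linear\<close>)

lemma prod_inner_Basis_vec: "(\<Prod>b\<in>Basis. (x::real^'n) \<bullet> b) = (\<Prod>i\<in>UNIV. x $ i)"
  by (simp add: Basis_vec_def axis_eq_axis prod.UNION_disjoint inner_axis)

text \<open>Borel-Lebesgue measure is determined by its values on boxes. The preimage of a box is a
  box with the same side lengths in another order.\<close>

lemma lborel_distr_relabel: "lborel = distr lborel borel (relabel :: real^'n \<Rightarrow> _)"
proof (rule lborel_eqI)
  have [measurable]: "(relabel :: real^'n \<Rightarrow> _) \<in> borel_measurable borel"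
    by (rule borel_measurable_continuous_onI[OF continuous_on_relabel])
  fix l u :: "real^'n enumerated"
  assume lu: "\<And>b. b \<in> Basis \<Longrightarrow> l \<bullet> b \<le> u \<bullet> b"
  have le: "l $ i \<le> u $ i" for i
    using lu[of "axis i 1"] by (simp add: inner_axis axis_in_Basis_iff)
  define l' u' :: "real^'n" where "l' = (\<chi> i. l $ enum i)" and "u' = (\<chi> i. u $ enum i)"
  have "x \<in> relabel -` box l u \<longleftrightarrow> x \<in> box l' u'" for x
  proof -
    have "x \<in> relabel -` box l u \<longleftrightarrow> (\<forall>i\<in>UNIV. l $ i < x $ unenum i \<and> x $ unenum i < u $ i)"
      by (simp add: mem_box_cart relabel_def)
    \<comment> \<open>Writing the index set as the range of \<open>enum\<close> turns the condition
      into one over the original indices.\<close>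
    also have "\<dots> \<longleftrightarrow> (\<forall>i\<in>range enum. l $ i < x $ unenum i \<and> x $ unenum i < u $ i)"
      by (metis UNIV_I unenum_inverse rangeI)
    also have "\<dots> \<longleftrightarrow> x \<in> box l' u'"
      by (simp add: mem_box_cart l'_def u'_def enum_inverse)
    finally show ?thesis .
  qed
  then have "relabel -` box l u = box l' u'" by blast
  moreover have "emeasure lborel (box l' u') = (\<Prod>b\<in>Basis. (u' - l') \<bullet> b)"
    by (rule emeasure_lborel_box) (auto simp: Basis_vec_def inner_axis l'_def u'_def le)
  moreover have "(\<Prod>i\<in>UNIV. (u' - l') $ unenum i) = (\<Prod>i\<in>UNIV. (u' - l') $ i)"
    by (rule prod.reindex_bij_betw[OF bij_unenum])
  ultimately show "emeasure (distr lborel borel (relabel :: real^'n \<Rightarrow> _)) (box l u) = (\<Prod>b\<in>Basis. (u - l) \<bullet> b)"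
    unfolding prod_inner_Basis_vec
    by (simp add: emeasure_distr u'_def l'_def unenum_inverse)
qed simp

lemma measure_relabel:
  fixes K :: "(real^'n) set"
  assumes "compact K"
  shows "measure lebesgue (relabel ` K) = measure lebesgue K"
proof -
  have m: "(relabel :: real^'n \<Rightarrow> _) \<in> lborel \<rightarrow>\<^sub>M borel"
    using borel_measurable_continuous_onI[OF continuous_on_relabel] by simp
  have c: "compact (relabel ` K)"
    by (intro compact_continuous_image continuous_on_relabel assms)
  have "measure lborel (relabel ` K) = measure (distr lborel borel relabel) (relabel ` K)"
    using lborel_distr_relabel[where 'n='n] by simp
  also have "\<dots> = measure lborel (relabel -` relabel ` K)"
    using measure_distr[OF m, of "relabel ` K"] c by (simp add: borel_compact)
  also have "relabel -` relabel ` K = K"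
    by (simp add: inj_relabel inj_vimage_image_eq)
  finally show ?thesis
    using assms c by (simp add: measure_completion borel_compact)
qed

lemma relabel_mink_comb: "relabel ` mink_comb r s K L = mink_comb r s (relabel ` K) (relabel ` L)"
proof -
  have *: "relabel (r *\<^sub>R x + s *\<^sub>R y) = r *\<^sub>R relabel x + s *\<^sub>R relabel y" for x y :: "real^'n"
    by (simp add: linear_add[OF linear_relabel] linear_cmul[OF linear_relabel])
  have "r *\<^sub>R relabel x + s *\<^sub>R relabel y \<in> relabel ` mink_comb r s K L" if "x \<in> K" "y \<in> L" for x y
    unfolding *[symmetric] mink_comb_iff using that by (intro imageI) (auto simp: mink_comb_iff)
  then show ?thesis by (auto simp: mink_comb_iff *) blast
qed

theorem measure_mink_comb_eq_mink_poly:
  fixes K L :: "(real^'n) set"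
  assumes K: "compact K" "convex K" "K \<noteq> {}" and L: "compact L" "convex L" "L \<noteq> {}" and rs: "r \<ge> 0" "s \<ge> 0"
  shows "measure lebesgue (mink_comb r s K L) = mink_poly (\<lambda>r s. measure lebesgue (mink_comb r s K L)) CARD('n) r s"
proof -
  have eq: "measure lebesgue (mink_comb r s (relabel ` K) (relabel ` L)) = measure lebesgue (mink_comb r s K L)" for r s
    using measure_relabel[OF compact_mink_comb[OF K(1) L(1)]] by (simp add: relabel_mink_comb)
  have *: "compact (relabel ` C)" "convex (relabel ` C)" if "compact C" "convex C" for C :: "(real^'n) set"
    using that by (auto intro!: compact_continuous_image continuous_on_relabel convex_linear_image linear_relabel)
  show ?thesis
    using measure_mink_comb_wellorder[of "relabel ` K" "relabel ` L", OF *[OF K(1,2)] _ *[OF L(1,2)] _ rs] K(3) L(3)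
    by (simp add: eq card_enumerated)
qed

text \<open>Rewrites the interpolation form into the monomial form demanded by
  \<open>polynomial_volume\<close>, by expanding the basis polynomials and moving the sums over
  nodes inside.\<close>

lemma mink_poly_expand:
  obtains a :: "nat \<Rightarrow> nat \<Rightarrow> real" where "\<And>r s. mink_poly V n r s = (\<Sum>k\<le>n. \<Sum>l\<le>n. a k l * r ^ k * s ^ l)"
proof (rule that)
  define c where "c i k = coeff (lagrange_basis n i) k" for i k
  have ex: "poly (lagrange_basis n i) x = (\<Sum>k\<le>n. c i k * x ^ k)" if "i \<le> n" for i x
    unfolding poly_altdef c_def using degree_lagrange_basis[OF that]
    by (intro sum.mono_neutral_left ballI) (simp_all add: coeff_eq_0)
  fix r s :: real
  have "mink_poly V n r s = (\<Sum>i\<le>n. \<Sum>j\<le>n. V (real i) (real j) * (\<Sum>k\<le>n. c i k * r ^ k) * (\<Sum>l\<le>n. c j l * s ^ l))"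
    unfolding mink_poly_def by (rule sum.cong[OF refl], rule sum.cong[OF refl]) (simp add: ex)
  also have "\<dots> = (\<Sum>i\<le>n. \<Sum>j\<le>n. \<Sum>k\<le>n. \<Sum>l\<le>n. V (real i) (real j) * c i k * c j l * r ^ k * s ^ l)"
    by (rule sum.cong[OF refl], rule sum.cong[OF refl]) (simp only: mult.assoc sum_product, simp only: sum_distrib_left mult_ac)
  also have "\<dots> = (\<Sum>i\<le>n. \<Sum>k\<le>n. \<Sum>j\<le>n. \<Sum>l\<le>n. V (real i) (real j) * c i k * c j l * r ^ k * s ^ l)"
    by (rule sum.cong[OF refl], rule sum.swap)
  also have "\<dots> = (\<Sum>k\<le>n. \<Sum>i\<le>n. \<Sum>j\<le>n. \<Sum>l\<le>n. V (real i) (real j) * c i k * c j l * r ^ k * s ^ l)"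
    by (rule sum.swap)
  also have "\<dots> = (\<Sum>k\<le>n. \<Sum>i\<le>n. \<Sum>l\<le>n. \<Sum>j\<le>n. V (real i) (real j) * c i k * c j l * r ^ k * s ^ l)"
    by (rule sum.cong[OF refl], rule sum.cong[OF refl], rule sum.swap)
  also have "\<dots> = (\<Sum>k\<le>n. \<Sum>l\<le>n. \<Sum>i\<le>n. \<Sum>j\<le>n. V (real i) (real j) * c i k * c j l * r ^ k * s ^ l)"
    by (rule sum.cong[OF refl], rule sum.swap)
  finally show "mink_poly V n r s = (\<Sum>k\<le>n. \<Sum>l\<le>n. (\<Sum>i\<le>n. \<Sum>j\<le>n. V (real i) (real j) * c i k * c j l) * r ^ k * s ^ l)"
    by (simp add: sum_distrib_right)
qed

subsection \<open>Support functions of symmetric bodies\<close>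

definition supp_fun :: "'a::euclidean_space set \<Rightarrow> 'a \<Rightarrow> real" where
  "supp_fun K u = Sup ((\<lambda>x. x \<bullet> u) ` K)"

lemma symmetric_bodiesD:
  assumes "K \<in> symmetric_bodies"
  shows "K \<noteq> {}" "compact K" "convex K" "x \<in> K \<Longrightarrow> - x \<in> K" "0 \<in> K"
proof -
  show *: "K \<noteq> {}" "compact K" "convex K"
    using assms by (auto simp: symmetric_bodies_def)
  show m: "- x \<in> K" if "x \<in> K" for x
    using assms that unfolding symmetric_bodies_def by (metis (mono_tags, lifting) image_eqI mem_Collect_eq)
  obtain x where "x \<in> K" using * by auto
  then have "(1/2) *\<^sub>R x + (1/2) *\<^sub>R (- x) \<in> K"
    using *(3) m by (intro convexD) auto
  then show "0 \<in> K" by simp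
qed

lemma symmetric_bodiesI:
  assumes "K \<noteq> {}" "compact K" "convex K" "\<And>x. x \<in> K \<Longrightarrow> - x \<in> K"
  shows "K \<in> symmetric_bodies"
  using assms unfolding symmetric_bodies_def by (force simp: image_iff)

lemma bdd_above_inner_image:
  fixes K :: "'a::euclidean_space set"
  assumes "compact K" shows "bdd_above ((\<lambda>x. x \<bullet> u) ` K)"
  using assms by (intro bounded_imp_bdd_above compact_imp_bounded compact_continuous_image continuous_intros)

lemma supp_fun_ge:
  assumes "compact K" "x \<in> K" shows "x \<bullet> u \<le> supp_fun K u"
  unfolding supp_fun_def using assms bdd_above_inner_image by (intro cSup_upper) auto

lemma supp_fun_attained:
  assumes "compact K" "K \<noteq> {}" obtains x where "x \<in> K" "x \<bullet> u = supp_fun K u"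
proof -
  obtain x where x: "x \<in> K" "\<And>y. y \<in> K \<Longrightarrow> y \<bullet> u \<le> x \<bullet> u"
    using continuous_attains_sup[OF assms, of "\<lambda>x. x \<bullet> u"] continuous_on_inner[OF continuous_on_id continuous_on_const] by blast
  then have "supp_fun K u = x \<bullet> u"
    unfolding supp_fun_def by (intro cSup_eq_maximum) auto
  with x that show ?thesis by auto
qed

lemma supp_fun_eqI:
  assumes "x \<in> K" "x \<bullet> u = c" "\<And>y. y \<in> K \<Longrightarrow> y \<bullet> u \<le> c"
  shows "supp_fun K u = c"
  unfolding supp_fun_def using assms by (intro cSup_eq_maximum) auto

lemma supp_fun_nonneg:
  assumes "K \<in> symmetric_bodies" shows "supp_fun K u \<ge> 0"
  using supp_fun_ge[OF symmetric_bodiesD(2)[OF assms] symmetric_bodiesD(5)[OF assms], of u] by simp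

text \<open>Symmetry makes the support function even, hence the absolute value: for negative
  \<open>c\<close> the maximiser \<open>x\<close> is replaced by \<open>- x\<close>.\<close>

lemma supp_fun_scale:
  assumes "K \<in> symmetric_bodies" shows "supp_fun K (c *\<^sub>R u) = \<bar>c\<bar> * supp_fun K u"
proof -
  note K = symmetric_bodiesD[OF assms]
  obtain x where x: "x \<in> K" "x \<bullet> u = supp_fun K u" using supp_fun_attained[OF K(2,1)] .
  show ?thesis
  proof (rule supp_fun_eqI)
    show "(if c \<ge> 0 then x else - x) \<in> K" using K(4) x by auto
    show "(if c \<ge> 0 then x else - x) \<bullet> (c *\<^sub>R u) = \<bar>c\<bar> * supp_fun K u" using x by auto
    fix y assume y: "y \<in> K"
    have "\<bar>y \<bullet> u\<bar> \<le> supp_fun K u"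
      using supp_fun_ge[OF K(2) y, of u] supp_fun_ge[OF K(2) K(4)[OF y], of u] by auto
    then have "\<bar>c\<bar> * \<bar>y \<bullet> u\<bar> \<le> \<bar>c\<bar> * supp_fun K u" by (intro mult_left_mono) auto
    then show "y \<bullet> c *\<^sub>R u \<le> \<bar>c\<bar> * supp_fun K u" by (simp add: abs_mult[symmetric])
  qed
qed

lemma supp_fun_triangle:
  assumes "compact K" "K \<noteq> {}" shows "supp_fun K (u + v) \<le> supp_fun K u + supp_fun K v"
proof -
  obtain x where "x \<in> K" "x \<bullet> (u + v) = supp_fun K (u + v)" using supp_fun_attained[OF assms] .
  then show ?thesis using supp_fun_ge[OF assms(1), of x] by (metis add_mono inner_add_right)
qed

text \<open>A point outside a compact convex set is strictly separated from it by a hyperplane,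
  whose normal violates the inequality.\<close>

lemma mem_iff_inner_le_supp_fun:
  assumes "compact K" "convex K" "K \<noteq> {}"
  shows "x \<in> K \<longleftrightarrow> (\<forall>u. x \<bullet> u \<le> supp_fun K u)"
proof
  assume *: "\<forall>u. x \<bullet> u \<le> supp_fun K u"
  show "x \<in> K"
  proof (rule ccontr)
    assume "x \<notin> K"
    then obtain a b where ab: "a \<bullet> x < b" "\<forall>y\<in>K. a \<bullet> y > b"
      using separating_hyperplane_closed_point assms compact_imp_closed by blast
    obtain y where y: "y \<in> K" "y \<bullet> (-a) = supp_fun K (-a)" using supp_fun_attained[OF assms(1,3)] .
    have "a \<bullet> y > b" using ab y(1) by blast
    moreover have "- (a \<bullet> x) \<le> - (a \<bullet> y)"
      using spec[OF *, of "- a"] y(2) by (simp add: inner_commute)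
    ultimately show False using ab(1) by linarith
  qed
qed (use supp_fun_ge[OF assms(1)] in auto)

lemma supp_fun_inject:
  assumes "K \<in> symmetric_bodies" "L \<in> symmetric_bodies" "\<And>u. supp_fun K u = supp_fun L u"
  shows "K = L"
  using mem_iff_inner_le_supp_fun[OF symmetric_bodiesD(2,3,1)] assms by (metis set_eqI)

lemma supp_fun_set_plus:
  assumes "compact K" "K \<noteq> {}" "compact L" "L \<noteq> {}"
  shows "supp_fun (K + L) u = supp_fun K u + supp_fun L u"
proof -
  obtain x where x: "x \<in> K" "x \<bullet> u = supp_fun K u" using supp_fun_attained[OF assms(1,2)] .
  obtain y where y: "y \<in> L" "y \<bullet> u = supp_fun L u" using supp_fun_attained[OF assms(3,4)] .
  show ?thesis
    by (rule supp_fun_eqI[of "x + y"])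
      (use x y supp_fun_ge[OF assms(1)] supp_fun_ge[OF assms(3)] in \<open>auto simp: set_plus_def inner_add_left intro!: add_mono\<close>)
qed

lemma symmetric_bodies_set_plus:
  assumes "K \<in> symmetric_bodies" "L \<in> symmetric_bodies"
  shows "K + L \<in> symmetric_bodies"
proof (rule symmetric_bodiesI)
  note K = symmetric_bodiesD[OF assms(1)] and L = symmetric_bodiesD[OF assms(2)]
  show "K + L \<noteq> {}" using K(1) L(1) by (auto simp: set_plus_def)
  have "K + L = {x + y |x y. x \<in> K \<and> y \<in> L}" by (auto simp: set_plus_def)
  then show "compact (K + L)" using compact_sums[OF K(2) L(2)] by simp
  show "convex (K + L)" using K L by (intro convex_set_plus)
  show "- z \<in> K + L" if z: "z \<in> K + L" for z
  proof -
    obtain x y where "x \<in> K" "y \<in> L" "z = x + y" using z by (auto simp: set_plus_def)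
    then have "- x \<in> K" "- y \<in> L" "- z = - x + - y" using K(4) L(4) by auto
    then show ?thesis by (metis set_plus_intro)
  qed
qed

lemma symmetric_bodies_linear_image:
  fixes h :: "real^'n \<Rightarrow> real^'m"
  assumes "linear h" "K \<in> symmetric_bodies" shows "h ` K \<in> symmetric_bodies"
proof (rule symmetric_bodiesI)
  note K = symmetric_bodiesD[OF assms(2)]
  show "h ` K \<noteq> {}" using K(1) by auto
  show "compact (h ` K)" using K(2) assms(1)
    by (intro compact_continuous_image linear_continuous_on) (simp_all add: linear_linear)
  show "convex (h ` K)" using K(3) assms(1) by (intro convex_linear_image)
  show "- z \<in> h ` K" if "z \<in> h ` K" for z
    using that K(4) by (metis (no_types, opaque_lifting) assms(1) image_iff linear_neg)
qed

lemma symmetric_bodies_scale: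
  "K \<in> symmetric_bodies \<Longrightarrow> (\<lambda>x. r *\<^sub>R x) ` K \<in> symmetric_bodies"
  by (rule symmetric_bodies_linear_image[OF linear_scale_self])

lemma supp_fun_scale_body:
  assumes "K \<in> symmetric_bodies"
  shows "supp_fun ((\<lambda>x. r *\<^sub>R x) ` K) u = \<bar>r\<bar> * supp_fun K u"
proof -
  have "supp_fun ((\<lambda>x. r *\<^sub>R x) ` K) u = supp_fun K (r *\<^sub>R u)"
    by (simp add: supp_fun_def image_image)
  then show ?thesis by (simp add: supp_fun_scale[OF assms])
qed

section \<open>Segments and projections onto lines\<close>

definition seg :: "'a::real_vector \<Rightarrow> 'a set" where
  "seg a = (\<lambda>t. t *\<^sub>R a) ` {-1..1}"

lemma seg_symmetric_body: "seg a \<in> symmetric_bodies"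
proof (rule symmetric_bodiesI)
  show "seg a \<noteq> {}" by (auto simp: seg_def)
  show "compact (seg a)" unfolding seg_def by (intro compact_continuous_image continuous_intros) auto
  show "convex (seg a)" unfolding seg_def by (intro convex_linear_image linear_scaleR_left) auto
  show "- x \<in> seg a" if x: "x \<in> seg a" for x
  proof -
    obtain t where "t \<in> {-1..1}" "x = t *\<^sub>R a" using x by (auto simp: seg_def)
    then show ?thesis unfolding seg_def by (intro image_eqI[of _ _ "- t"]) auto
  qed
qed

lemma supp_fun_seg: "supp_fun (seg a) u = \<bar>a \<bullet> u\<bar>"
proof (rule supp_fun_eqI)
  show "sgn (a \<bullet> u) *\<^sub>R a \<in> seg a" unfolding seg_def by (intro imageI) (auto simp: sgn_if)
  show "sgn (a \<bullet> u) *\<^sub>R a \<bullet> u = \<bar>a \<bullet> u\<bar>" by (simp add: abs_sgn mult.commute)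
  fix y assume "y \<in> seg a"
  then obtain t where "t \<in> {-1..1}" and y: "y = t *\<^sub>R a" unfolding seg_def by blast
  then have t: "\<bar>t\<bar> \<le> 1" by auto
  have "t * (a \<bullet> u) \<le> \<bar>t\<bar> * \<bar>a \<bullet> u\<bar>" by (metis abs_ge_self abs_mult)
  also have "\<dots> \<le> 1 * \<bar>a \<bullet> u\<bar>" using t by (intro mult_right_mono) auto
  finally show "y \<bullet> u \<le> \<bar>a \<bullet> u\<bar>" using y by simp
qed

lemma orth_proj_span:
  assumes "norm v = 1" shows "orth_proj (span {v}) x = (x \<bullet> v) *\<^sub>R v"
  unfolding orth_proj_def
proof (rule the_equality)
  have vv: "v \<bullet> v = 1" using assms by (simp add: dot_square_norm)
  show "(x \<bullet> v) *\<^sub>R v \<in> span {v} \<and> (\<forall>z\<in>span {v}. orthogonal (x - (x \<bullet> v) *\<^sub>R v) z)"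
    by (auto simp: span_singleton orthogonal_def inner_diff_left vv)
  fix y assume y: "y \<in> span {v} \<and> (\<forall>z\<in>span {v}. orthogonal (x - y) z)"
  then obtain c where c: "y = c *\<^sub>R v" by (auto simp: span_singleton)
  have "orthogonal (x - y) v" using y span_base[of v "{v}"] by blast
  then show "y = (x \<bullet> v) *\<^sub>R v" by (simp add: c orthogonal_def inner_diff_left vv)
qed

text \<open>The image on a line is a symmetric segment whose half-length is the support value.
  Covariance under projection onto lines thereby becomes a statement about support
  functions.\<close>

lemma orth_proj_span_image:
  assumes "norm v = 1" "K \<in> symmetric_bodies"
  shows "orth_proj (span {v}) ` K = seg (supp_fun K v *\<^sub>R v)"
proof
  note K = symmetric_bodiesD[OF assms(2)]
  obtain x where x: "x \<in> K" "x \<bullet> v = supp_fun K v" using supp_fun_attained[OF K(2,1)] .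
  have "t *\<^sub>R x \<in> K" if "t \<in> {-1..1}" for t
  proof -
    have "((1 + t) / 2) *\<^sub>R x + ((1 - t) / 2) *\<^sub>R (- x) \<in> K"
      using K x that by (intro convexD) (auto simp: field_simps)
    also have "((1 + t) / 2) *\<^sub>R x + ((1 - t) / 2) *\<^sub>R (- x) = ((1 + t) / 2 - (1 - t) / 2) *\<^sub>R x"
      by (simp add: scaleR_diff_left)
    also have "(1 + t) / 2 - (1 - t) / 2 = t" by (simp add: field_simps)
    finally show ?thesis .
  qed
  then show "seg (supp_fun K v *\<^sub>R v) \<subseteq> orth_proj (span {v}) ` K"
    using x unfolding seg_def orth_proj_span[OF assms(1), abs_def]
    by (force simp: image_iff)
  show "orth_proj (span {v}) ` K \<subseteq> seg (supp_fun K v *\<^sub>R v)"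
  proof (clarsimp simp: orth_proj_span[OF assms(1)])
    fix y assume y: "y \<in> K"
    have b: "\<bar>y \<bullet> v\<bar> \<le> supp_fun K v"
      using supp_fun_ge[OF K(2) y, of v] supp_fun_ge[OF K(2) K(4)[OF y], of v] by auto
    show "(y \<bullet> v) *\<^sub>R v \<in> seg (supp_fun K v *\<^sub>R v)"
    \<comment> \<open>The segment parameter is \<open>(y \<bullet> v) / supp_fun K v\<close>, so a
      vanishing support value is treated apart.\<close>
    proof (cases "supp_fun K v = 0")
      case True
      then show ?thesis using b by (auto simp: seg_def image_iff)
    next
      case False
      then have "supp_fun K v > 0" using b by linarith
      then show ?thesis using b unfolding seg_def
        by (intro image_eqI[of _ _ "(y \<bullet> v) / supp_fun K v"]) (auto simp: abs_le_iff field_simps)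
    qed
  qed
qed

text \<open>In dimension at least two \<open>v\<close> can be rotated towards a unit vector
  orthogonal to it, which realises every cosine between 0 and 1.\<close>

lemma exists_unit_vector_with_inner:
  fixes v :: "'a::euclidean_space"
  assumes "DIM('a) \<ge> 2" "norm v = 1" "0 \<le> c" "c \<le> 1"
  obtains u where "norm u = 1" "u \<bullet> v = c"
proof -
  obtain y where y: "y \<noteq> 0" "orthogonal v y" using orthogonal_to_vector_exists[OF assms(1)] by metis
  define w where "w = sgn y"
  have w: "norm w = 1" "w \<bullet> v = 0" "v \<bullet> w = 0"
    using y by (auto simp: w_def norm_sgn sgn_div_norm orthogonal_def inner_commute)
  define u where "u = c *\<^sub>R v + sqrt (1 - c\<^sup>2) *\<^sub>R w"
  have vv: "v \<bullet> v = 1" "w \<bullet> w = 1" using assms w by (simp_all add: dot_square_norm)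
  have "c\<^sup>2 \<le> 1" using assms by (simp add: power_le_one)
  then have "u \<bullet> u = 1"
    by (simp add: u_def inner_add_left inner_add_right vv w power2_eq_square[symmetric] mult.assoc[symmetric])
  then have "norm u = 1" by (simp add: norm_eq_sqrt_inner)
  moreover have "u \<bullet> v = c" by (simp add: u_def inner_add_left vv w)
  ultimately show ?thesis using that by blast
qed

subsection \<open>Projection covariant operations\<close>

locale covariant_op =
  fixes f :: "(real ^ 'n) set \<Rightarrow> (real ^ 'n) set \<Rightarrow> (real ^ 'n) set"
  assumes card2: "CARD('n) \<ge> 2"
    and closed: "\<And>K L. K \<in> symmetric_bodies \<Longrightarrow> L \<in> symmetric_bodies \<Longrightarrow> f K L \<in> symmetric_bodies"
    and covariant: "projection_covariant f"
begin

definition line_fun :: "real^'n \<Rightarrow> real \<Rightarrow> real \<Rightarrow> real" where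
  "line_fun v s t = supp_fun (f (seg (s *\<^sub>R v)) (seg (t *\<^sub>R v))) v"

text \<open>Covariance for the line through \<open>v\<close>, whose dimension 1 is at most
  \<open>CARD('n) - 1\<close> because \<open>CARD('n) \<ge> 2\<close>. The operation thus acts on
  support values in each direction separately.\<close>

lemma seg_supp_fun:
  assumes "norm v = 1" "K \<in> symmetric_bodies" "L \<in> symmetric_bodies"
  shows "seg (supp_fun (f K L) v *\<^sub>R v) = f (seg (supp_fun K v *\<^sub>R v)) (seg (supp_fun L v *\<^sub>R v))"
proof -
  have "v \<noteq> 0" using assms by auto
  then have "dim (span {v}) = 1" by (simp add: dim_eq_card_independent)
  then have "orth_proj (span {v}) ` f K L = f (orth_proj (span {v}) ` K) (orth_proj (span {v}) ` L)"
    using covariant card2 assms subspace_span unfolding projection_covariant_def by (metis One_nat_def Suc_1 diff_le_mono diff_Suc_1 le_refl)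
  then show ?thesis by (simp add: orth_proj_span_image assms closed)
qed

lemma supp_fun_eq_line_fun:
  assumes "norm v = 1" "K \<in> symmetric_bodies" "L \<in> symmetric_bodies"
  shows "supp_fun (f K L) v = line_fun v (supp_fun K v) (supp_fun L v)"
proof -
  have "supp_fun (seg (supp_fun (f K L) v *\<^sub>R v)) v = supp_fun (f K L) v"
    using assms supp_fun_nonneg[OF closed[OF assms(2,3)]] by (simp add: supp_fun_seg dot_square_norm)
  then show ?thesis by (simp add: line_fun_def seg_supp_fun[OF assms])
qed

lemma line_op:
  assumes "norm v = 1" "s \<ge> 0" "t \<ge> 0"
  shows "f (seg (s *\<^sub>R v)) (seg (t *\<^sub>R v)) = seg (line_fun v s t *\<^sub>R v)"
  using seg_supp_fun[OF assms(1) seg_symmetric_body seg_symmetric_body, of "s *\<^sub>R v" "t *\<^sub>R v"] assms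
  by (simp add: supp_fun_seg dot_square_norm line_fun_def)

text \<open>The support value in direction \<open>u\<close> of the operation applied to two segments
  along \<open>v\<close> is computed twice: from the resulting segment along \<open>v\<close>, and
  from the projections of the two segments onto the line of \<open>u\<close>.\<close>

lemma line_fun_inner:
  assumes "norm u = 1" "norm v = 1" "s \<ge> 0" "t \<ge> 0"
  shows "line_fun u (\<bar>u \<bullet> v\<bar> * s) (\<bar>u \<bullet> v\<bar> * t) = \<bar>u \<bullet> v\<bar> * line_fun v s t"
proof -
  have "0 \<le> line_fun v s t"
    unfolding line_fun_def by (intro supp_fun_nonneg closed seg_symmetric_body)
  then have "\<bar>u \<bullet> v\<bar> * line_fun v s t = supp_fun (f (seg (s *\<^sub>R v)) (seg (t *\<^sub>R v))) u"
    by (simp add: line_op assms supp_fun_seg abs_mult inner_commute)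
  also have "\<dots> = line_fun u (\<bar>u \<bullet> v\<bar> * s) (\<bar>u \<bullet> v\<bar> * t)"
    using assms by (simp add: supp_fun_eq_line_fun seg_symmetric_body supp_fun_seg abs_mult inner_commute mult.commute)
  finally show ?thesis by simp
qed

lemma line_fun_homogeneous:
  assumes "norm v = 1" "s \<ge> 0" "t \<ge> 0" "c \<ge> 0"
  shows "line_fun v (c * s) (c * t) = c * line_fun v s t"
proof -
  have small: "line_fun v (c * s) (c * t) = c * line_fun v s t" 
    if st: "s \<ge> 0" "t \<ge> 0" and c: "0 \<le> c" "c \<le> 1" for c s t
  proof -
    obtain u where u: "norm u = 1" "u \<bullet> v = sqrt c"
      using exists_unit_vector_with_inner[OF _ assms(1), of "sqrt c"] card2 c by auto
    then have "line_fun u (sqrt c * s) (sqrt c * t) = sqrt c * line_fun v s t"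
      using line_fun_inner[OF u(1) assms(1) st] c by simp
    \<comment> \<open>Going from \<open>v\<close> to \<open>u\<close> and back scales by \<open>(u \<bullet> v)\<^sup>2 = c\<close>.\<close>
    moreover have "line_fun v (sqrt c * (sqrt c * s)) (sqrt c * (sqrt c * t)) = sqrt c * line_fun u (sqrt c * s) (sqrt c * t)"
      using line_fun_inner[OF assms(1) u(1), of "sqrt c * s" "sqrt c * t"] u c st by (simp add: inner_commute)
    ultimately show ?thesis using c by (simp add: mult.assoc[symmetric])
  qed
  show ?thesis
  proof (cases "c \<le> 1")
    \<comment> \<open>A factor above 1 is undone by its inverse, to which the case of small factors
      applies.\<close>
    case False
    have "line_fun v (inverse c * (c * s)) (inverse c * (c * t)) = inverse c * line_fun v (c * s) (c * t)"
      using False assms by (intro small) (auto simp: field_simps)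
    then show ?thesis using False by (simp add: field_simps)
  qed (use small assms in auto)
qed

text \<open>For directions that are not orthogonal, homogeneity cancels the factor
  \<open>\<bar>u \<bullet> v\<bar>\<close>. Orthogonal directions are compared through their
  bisector \<open>w\<close>.\<close>

lemma line_fun_unique:
  assumes "norm u = 1" "norm v = 1" "s \<ge> 0" "t \<ge> 0"
  shows "line_fun u s t = line_fun v s t"
proof -
  have *: "line_fun u s t = line_fun v s t" if "u \<bullet> v \<noteq> 0" "norm u = 1" "norm v = 1" for u v
    using line_fun_inner[OF that(2,3) assms(3,4)] line_fun_homogeneous[OF that(2) assms(3,4), of "\<bar>u \<bullet> v\<bar>"] that(1) by simp
  show ?thesis
  proof (cases "u \<bullet> v = 0")
    case True
    define w where "w = sgn (u + v)"
    have "u \<bullet> u = 1" "v \<bullet> v = 1" using assms by (simp_all add: dot_square_norm)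
    then have uv: "u \<bullet> (u + v) = 1" "v \<bullet> (u + v) = 1" using True by (auto simp: inner_add_right inner_commute)
    then have "u + v \<noteq> 0" by auto
    then have "norm w = 1" "u \<bullet> w \<noteq> 0" "w \<bullet> v \<noteq> 0"
      using uv by (auto simp: w_def norm_sgn sgn_div_norm inner_commute)
    then show ?thesis using * assms by metis
  qed (use * assms in auto)
qed

text \<open>An arbitrary coordinate axis serves as reference; by \<open>line_fun_unique\<close> the
  choice does not affect the values at nonnegative arguments.\<close>

definition phi :: "real \<Rightarrow> real \<Rightarrow> real" where
  "phi = line_fun (axis (SOME i. True) 1)"

lemma phi_eq: "norm v = 1 \<Longrightarrow> s \<ge> 0 \<Longrightarrow> t \<ge> 0 \<Longrightarrow> line_fun v s t = phi s t"
  unfolding phi_def by (rule line_fun_unique) (auto simp: norm_axis_1)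

lemma phi_nonneg: "phi s t \<ge> 0"
  unfolding phi_def line_fun_def by (intro supp_fun_nonneg closed seg_symmetric_body)

lemma phi_homogeneous: "s \<ge> 0 \<Longrightarrow> t \<ge> 0 \<Longrightarrow> c \<ge> 0 \<Longrightarrow> phi (c * s) (c * t) = c * phi s t"
  unfolding phi_def by (intro line_fun_homogeneous) (auto simp: norm_axis_1)

text \<open>For unit vectors this is \<open>supp_fun_eq_line_fun\<close>; homogeneity of support
  functions and of \<open>phi\<close> extends it to all vectors.\<close>

lemma supp_fun_op:
  assumes K: "K \<in> symmetric_bodies" and L: "L \<in> symmetric_bodies"
  shows "supp_fun (f K L) x = phi (supp_fun K x) (supp_fun L x)"
proof (cases "x = 0")
  case True
  have "supp_fun M 0 = 0" if "M \<in> symmetric_bodies" for M :: "(real^'n) set"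
    using supp_fun_scale[OF that, of 0 0] by simp
  moreover have "phi 0 0 = 0" using phi_homogeneous[of 0 0 0] by simp
  ultimately show ?thesis using True assms closed by simp
next
  case False
  then have n: "norm (sgn x) = 1" by (simp add: norm_sgn)
  have x: "supp_fun M x = norm x * supp_fun M (sgn x)" if "M \<in> symmetric_bodies" for M :: "(real^'n) set"
    using supp_fun_scale[OF that, of "norm x" "sgn x"] False by (simp add: sgn_div_norm)
  show ?thesis
    using supp_fun_eq_line_fun[OF n K L]
    by (simp add: x[OF K] x[OF L] x[OF closed[OF K L]] phi_eq[OF n] phi_homogeneous supp_fun_nonneg K L)
qed

text \<open>For two orthogonal segments the support function of the resulting body at
  \<open>x *\<^sub>R ?a + y *\<^sub>R ?b\<close> is
  \<open>phi (s * \<bar>x\<bar>) (t * \<bar>y\<bar>)\<close>. The bounds are instances of its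
  subadditivity.\<close>

lemma phi_bounds:
  assumes "s \<ge> 0" "t \<ge> 0"
  shows "phi s 0 \<le> phi s t" "phi 0 t \<le> phi s t" "phi s t \<le> phi s 0 + phi 0 t"
proof -
  obtain i j :: 'n where ij: "i \<noteq> j"
  proof -
    have "\<not> CARD('n) \<le> Suc 0" using card2 by simp
    then show ?thesis using that by (auto simp: card_le_Suc0_iff_eq)
  qed
  let ?a = "axis i (1::real)" and ?b = "axis j (1::real)"
  let ?K = "seg (s *\<^sub>R ?a)" and ?L = "seg (t *\<^sub>R ?b)"
  define M where "M = f ?K ?L"
  have [simp]: "?a \<bullet> ?a = 1" "?b \<bullet> ?b = 1" "?a \<bullet> ?b = 0" "?b \<bullet> ?a = 0" 
    using ij by (auto simp: inner_axis_axis)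
  have M: "M \<in> symmetric_bodies" unfolding M_def by (intro closed seg_symmetric_body)
  have h: "supp_fun M (x *\<^sub>R ?a + y *\<^sub>R ?b) = phi (s * \<bar>x\<bar>) (t * \<bar>y\<bar>)" for x y
    using assms by (simp add: M_def supp_fun_op seg_symmetric_body supp_fun_seg inner_add_right abs_mult mult.commute)
  note tri = supp_fun_triangle[OF symmetric_bodiesD(2,1)[OF M]]
  have 2: "phi (s * 2) 0 = 2 * phi s 0" "phi 0 (t * 2) = 2 * phi 0 t"
    using phi_homogeneous[of s 0 2] phi_homogeneous[of 0 t 2] assms by (simp_all add: mult.commute)
  \<comment> \<open>Twice \<open>?a\<close> is the sum of \<open>?a + ?b\<close> and
    \<open>?a - ?b\<close>, and at both of these the support value is
    \<open>phi s t\<close>.\<close>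
  have "supp_fun M (2 *\<^sub>R ?a + 0 *\<^sub>R ?b) \<le> supp_fun M (1 *\<^sub>R ?a + 1 *\<^sub>R ?b) + supp_fun M (1 *\<^sub>R ?a + (-1) *\<^sub>R ?b)"
    using tri[of "?a + ?b" "?a - ?b"] by (simp add: scaleR_2)
  then show "phi s 0 \<le> phi s t" unfolding h using 2 by simp
  have "supp_fun M (0 *\<^sub>R ?a + 2 *\<^sub>R ?b) \<le> supp_fun M (1 *\<^sub>R ?a + 1 *\<^sub>R ?b) + supp_fun M ((-1) *\<^sub>R ?a + 1 *\<^sub>R ?b)"
    using tri[of "?a + ?b" "- ?a + ?b"] by (simp add: scaleR_2)
  then show "phi 0 t \<le> phi s t" unfolding h using 2 by simp
  have "supp_fun M (1 *\<^sub>R ?a + 1 *\<^sub>R ?b) \<le> supp_fun M (1 *\<^sub>R ?a + 0 *\<^sub>R ?b) + supp_fun M (0 *\<^sub>R ?a + 1 *\<^sub>R ?b)"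
    using tri[of "?a" "?b"] by simp
  then show "phi s t \<le> phi s 0 + phi 0 t" unfolding h by simp
qed

lemma op_eqI:
  assumes "\<And>K L. K \<in> symmetric_bodies \<Longrightarrow> L \<in> symmetric_bodies \<Longrightarrow> g K L \<in> symmetric_bodies"
    and "\<And>K L u. K \<in> symmetric_bodies \<Longrightarrow> L \<in> symmetric_bodies \<Longrightarrow>
           supp_fun (g K L) u = phi (supp_fun K u) (supp_fun L u)"
    and "K \<in> symmetric_bodies" "L \<in> symmetric_bodies"
  shows "f K L = g K L"
  by (rule supp_fun_inject) (simp_all add: assms closed supp_fun_op)

end

subsection \<open>Associativity and polynomial volume\<close>

text \<open>For a degree of at least two, the quotient by \<open>x ^ degree q\<close> would tend
  both to the leading coefficient and to 0.\<close>

lemma degree_le_1_if_linear_growth: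
  fixes q :: "real poly"
  assumes "\<And>s. s \<ge> 0 \<Longrightarrow> \<bar>poly q s\<bar> \<le> A * (1 + s)"
  shows "degree q \<le> 1"
proof (rule ccontr)
  assume d: "\<not> degree q \<le> 1"
  have "((\<lambda>x. poly q x / x ^ degree q) \<longlongrightarrow> lead_coeff q) at_top"
    using poly_divide_tendsto_aux[of q] by (rule filterlim_mono) (auto simp: at_top_le_at_infinity)
  moreover have "((\<lambda>x. poly q x / x ^ degree q) \<longlongrightarrow> 0) at_top"
  proof (rule Lim_null_comparison)
    show "\<forall>\<^sub>F x in at_top. norm (poly q x / x ^ degree q) \<le> 2 * \<bar>A\<bar> * inverse x"
      using eventually_ge_at_top[of 1]
    proof eventually_elim
      case (elim x)
      have "\<bar>poly q x\<bar> \<le> \<bar>A\<bar> * (1 + x)"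
        using assms[of x] elim by (smt (verit) mult_right_mono)
      also have "\<dots> \<le> \<bar>A\<bar> * (2 * x)" using elim by (intro mult_left_mono) auto
      finally have 1: "\<bar>poly q x\<bar> \<le> 2 * \<bar>A\<bar> * x" by simp
      have 2: "x ^ 2 \<le> x ^ degree q" using d elim by (intro power_increasing) auto
      have "norm (poly q x / x ^ degree q) = \<bar>poly q x\<bar> / x ^ degree q" using elim by simp
      also have "\<dots> \<le> (2 * \<bar>A\<bar> * x) / x ^ 2" using 1 2 elim by (intro frac_le) auto
      also have "\<dots> = 2 * \<bar>A\<bar> * inverse x" using elim by (simp add: power2_eq_square field_simps)
      finally show ?case .
    qed
    show "((\<lambda>x. 2 * \<bar>A\<bar> * inverse x) \<longlongrightarrow> 0) at_top"
      by (intro tendsto_mult_right_zero tendsto_inverse_0_at_top filterlim_ident)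
  qed
  ultimately have "lead_coeff q = 0" by (rule tendsto_unique[OF trivial_limit_at_top_linorder])
  then show False using d by simp
qed

text \<open>Linear growth makes \<open>q\<close> affine. The bound \<open>le2\<close> touches
  \<open>q\<close> at 0 and is flat there because \<open>k \<ge> 2\<close>, so the slope of
  \<open>q\<close> is at most 0, against \<open>s \<le> poly q s\<close>.\<close>

lemma no_polynomial_growth:
  fixes q :: "real poly"
  assumes k: "k \<ge> 2" and A: "A > 0"
    and ge: "\<And>s. s \<ge> 0 \<Longrightarrow> s \<le> poly q s"
    and le1: "\<And>s. s \<ge> 0 \<Longrightarrow> poly q s \<le> A * (1 + s)"
    and le2: "\<And>s. s \<ge> 0 \<Longrightarrow> poly q s \<le> A * (1 + s ^ k) ^ n"
    and q0: "poly q 0 = A"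
  shows False
proof -
  have "degree q \<le> 1"
  proof (rule degree_le_1_if_linear_growth)
    show "\<bar>poly q s\<bar> \<le> A * (1 + s)" if "s \<ge> 0" for s
      using ge[OF that] le1[OF that] that by linarith
  qed
  then have q: "poly q s = A + coeff q 1 * s" for s
    using q0 by (cases "degree q = 0") (auto simp: poly_altdef coeff_eq_0 poly_0_coeff_0 le_Suc_eq)
  define b where "b = coeff q 1"
  have "((\<lambda>s. A * (1 + s ^ k) ^ n - A - b * s) has_real_derivative - b) (at 0)"
    using k by (auto intro!: derivative_eq_intros simp: power_0_left)
  then have "((\<lambda>s. A * (1 + s ^ k) ^ n - A - b * s) has_real_derivative - b) (at_right 0)"
    by (rule has_field_derivative_at_within)
  then have "((\<lambda>s. (A * (1 + s ^ k) ^ n - A - b * s) / s) \<longlongrightarrow> - b) (at_right 0)"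
    using k by (simp add: has_field_derivative_iff power_0_left)
  moreover have "\<forall>\<^sub>F s in at_right 0. 0 \<le> (A * (1 + s ^ k) ^ n - A - b * s) / s"
    unfolding eventually_at_right_field
  proof (intro exI[of _ 1] conjI allI impI)
    fix s :: real assume "0 < s" "s < 1"
    then show "0 \<le> (A * (1 + s ^ k) ^ n - A - b * s) / s"
      using le2[of s] q[of s] by (simp add: b_def)
  qed simp
  ultimately have "0 \<le> - b" by (rule tendsto_lowerbound) simp
  \<comment> \<open>At \<open>A + 1\<close> the nonincreasing \<open>q\<close> is at most
    \<open>A\<close>, while \<open>ge\<close> demands at least \<open>A + 1\<close>.\<close>
  then have "poly q (A + 1) \<le> A" using A q[of "A + 1"] by (simp add: b_def mult_nonpos_nonneg)
  with ge[of "A + 1"] A show False by linarith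
qed

text \<open>The exponent \<open>k\<close> is the order of the zero of \<open>p - 1\<close> at 0; it
  is finite since \<open>p - 1\<close> does not vanish at 2.\<close>

lemma poly_eq_1_plus_power:
  fixes p :: "real poly"
  assumes "poly p 0 = 1" "poly p 2 \<noteq> 1"
  obtains k q where "k \<ge> 1" "poly q 0 \<noteq> 0" "\<And>t. poly p t = 1 + t ^ k * poly q t"
proof -
  have nz: "p - 1 \<noteq> 0" using assms(2) by auto
  from order_decomp[OF nz, of 0] obtain q where
    q: "p - 1 = [:- 0, 1:] ^ order 0 (p - 1) * q" "\<not> [:- 0, 1:] dvd q" by blast
  have "poly (p - 1) t = t ^ order 0 (p - 1) * poly q t" for t
    by (subst q(1)) simp
  then have *: "poly p t = 1 + t ^ order 0 (p - 1) * poly q t" for t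
    by (simp add: algebra_simps)
  have "order 0 (p - 1) \<noteq> 0" using assms(1) nz order_root[of "p - 1" 0] by simp
  moreover have "poly q 0 \<noteq> 0" using q(2) by (simp add: poly_eq_0_iff_dvd)
  ultimately show ?thesis using that[of "order 0 (p - 1)" q] * by (simp add: Suc_leI)
qed

text \<open>By homogeneity everything is encoded in \<open>F t = \<phi> 1 t\<close>. As the
  \<open>n\<close>-th power of \<open>F\<close> is a polynomial, \<open>F - 1\<close> has an exact
  leading power \<open>t ^ k\<close> at 0, and associativity transfers this behaviour near 0 to
  every ratio.\<close>

lemma power_law_of_associative:
  fixes \<phi> :: "real \<Rightarrow> real \<Rightarrow> real"
  assumes hom: "\<And>s t c. s \<ge> 0 \<Longrightarrow> t \<ge> 0 \<Longrightarrow> c \<ge> 0 \<Longrightarrow> \<phi> (c * s) (c * t) = c * \<phi> s t"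
    and assoc: "\<And>r s t. r \<ge> 0 \<Longrightarrow> s \<ge> 0 \<Longrightarrow> t \<ge> 0 \<Longrightarrow> \<phi> r (\<phi> s t) = \<phi> (\<phi> r s) t"
    and ge: "\<And>s t. s \<ge> 0 \<Longrightarrow> t \<ge> 0 \<Longrightarrow> s \<le> \<phi> s t \<and> t \<le> \<phi> s t"
    and le: "\<And>s t. s \<ge> 0 \<Longrightarrow> t \<ge> 0 \<Longrightarrow> \<phi> s t \<le> s + t"
    and n: "n \<ge> 1" and p: "\<And>t. t \<ge> 0 \<Longrightarrow> \<phi> 1 t ^ n = poly p t"
  obtains k where "k \<ge> 1" "\<And>s t. s \<ge> 0 \<Longrightarrow> t \<ge> 0 \<Longrightarrow> \<phi> s t ^ k = s ^ k + t ^ k"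
proof -
  define F where "F = \<phi> 1"
  have F: "1 \<le> F t" "t \<le> F t" "F t \<le> 1 + t" if "t \<ge> 0" for t
    using ge[of 1 t] le[of 1 t] that by (auto simp: F_def)
  have \<phi>: "\<phi> s t = s * F (t / s)" if "s > 0" "t \<ge> 0" for s t
    using hom[of 1 "t / s" s] that by (simp add: F_def)
  have "poly p 0 = 1" using p[of 0] F[of 0] by (simp add: F_def)
  moreover have "(1::real) < 2 ^ n" using n by simp
  then have "1 < poly p 2" using p[of 2] F(2)[of 2] power_mono[of 2 "F 2" n] by (simp add: F_def)
  ultimately obtain k q where kq: "k \<ge> 1" "poly q 0 \<noteq> 0" "\<And>t. poly p t = 1 + t ^ k * poly q t"
    using poly_eq_1_plus_power[of p] by (metis less_irrefl)
  define C where "C = poly q 0 / n"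
  define W where "W t = (F t - 1) / t ^ k" for t
  have C: "C \<noteq> 0" using kq(2) n by (simp add: C_def)
  have F1: "(F \<longlongrightarrow> 1) (at_right 0)"
  proof (rule tendsto_sandwich)
    show "\<forall>\<^sub>F t in at_right 0. 1 \<le> F t" "\<forall>\<^sub>F t in at_right 0. F t \<le> 1 + t"
      using F by (auto simp: eventually_at_right_field intro!: exI[of _ 1])
    show "((\<lambda>t. 1 + t) \<longlongrightarrow> 1) (at_right (0::real))" by (auto intro!: tendsto_eq_intros)
  qed auto
  \<comment> \<open>Factoring \<open>F t ^ n - 1\<close> as \<open>F t - 1\<close> times a geometric
    sum extracts the expansion of \<open>F\<close> from that of its power. The sum tends to
    \<open>n\<close>, which explains the constant \<open>C\<close>.\<close>
  have W: "(W \<longlongrightarrow> C) (at_right 0)"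
  proof -
    have "((\<lambda>t. poly q t / (\<Sum>i<n. F t ^ i)) \<longlongrightarrow> poly q 0 / (\<Sum>i<n. 1 ^ i)) (at_right 0)"
      using n by (intro tendsto_intros F1) auto
    then have "((\<lambda>t. poly q t / (\<Sum>i<n. F t ^ i)) \<longlongrightarrow> C) (at_right 0)" by (simp add: C_def)
    moreover have "\<forall>\<^sub>F t in at_right 0. poly q t / (\<Sum>i<n. F t ^ i) = W t"
      unfolding eventually_at_right_field
    proof (intro exI[of _ 1] conjI allI impI)
      fix t :: real assume t: "0 < t" "t < 1"
      have "F t ^ n - 1 = t ^ k * poly q t" using p[of t] kq(3)[of t] t by (simp add: F_def)
      moreover have "F t ^ n - 1 = (F t - 1) * (\<Sum>i<n. F t ^ i)" by (rule power_diff_1_eq)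
      moreover have "(\<Sum>i<n. F t ^ i) > 0"
        using n F(1)[of t] t by (intro sum_pos) (auto simp: lessThan_empty_iff)
      ultimately show "poly q t / (\<Sum>i<n. F t ^ i) = W t"
        using t by (simp add: W_def field_simps)
    qed simp
    ultimately show ?thesis by (rule Lim_transform_eventually)
  qed
  have law: "F \<rho> ^ k = 1 + \<rho> ^ k" if \<rho>: "\<rho> > 0" for \<rho>
  proof -
    have F\<rho>: "F \<rho> > 0" using F(1)[of \<rho>] \<rho> by linarith
    \<comment> \<open>Both inner arguments in the comparison below tend to 0 through positive
      values, so the limit of \<open>W\<close> applies to them.\<close>
    have l1: "filterlim (\<lambda>t. t * F \<rho>) (at_right 0) (at_right 0)"
      unfolding filterlim_at using F\<rho>
      by (auto intro!: tendsto_eq_intros simp: eventually_at_right_field intro: exI[of _ 1])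
    have l2: "filterlim (\<lambda>t. t * \<rho> / F t) (at_right 0) (at_right 0)"
      unfolding filterlim_at
    proof
      show "\<forall>\<^sub>F t in at_right 0. t * \<rho> / F t \<in> {0<..} \<and> t * \<rho> / F t \<noteq> 0"
        unfolding eventually_at_right_field
      proof (intro exI[of _ 1] conjI allI impI)
        fix t :: real assume t: "0 < t" "t < 1"
        then have "F t > 0" using F(1)[of t] by linarith
        then show "t * \<rho> / F t \<in> {0<..}" "t * \<rho> / F t \<noteq> 0" using t \<rho> by auto
      qed simp
      show "((\<lambda>t. t * \<rho> / F t) \<longlongrightarrow> 0) (at_right 0)"
        by (rule tendsto_eq_intros F1 refl | simp)+
    qed
    have "((\<lambda>t. W (t * F \<rho>) * F \<rho> ^ k) \<longlongrightarrow> C * F \<rho> ^ k) (at_right 0)"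
      by (intro tendsto_intros filterlim_compose[OF W l1])
    moreover have "((\<lambda>t. W t + F t * W (t * \<rho> / F t) * (\<rho> / F t) ^ k) \<longlongrightarrow> C + 1 * C * (\<rho> / 1) ^ k) (at_right 0)"
      by (intro tendsto_intros filterlim_compose[OF W l2] W F1) auto
    moreover have "\<forall>\<^sub>F t in at_right 0. W (t * F \<rho>) * F \<rho> ^ k = W t + F t * W (t * \<rho> / F t) * (\<rho> / F t) ^ k"
      unfolding eventually_at_right_field
    proof (intro exI[of _ 1] conjI allI impI)
      fix t :: real assume t: "0 < t" "t < 1"
      have Ft: "F t > 0" using t F(1)[of t] by linarith
      \<comment> \<open>Associativity at \<open>1\<close>, \<open>t\<close> and
        \<open>t * \<rho>\<close>: for a fixed ratio \<open>\<rho>\<close>, the last two arguments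
        shrink together and the terms of order \<open>t ^ k\<close> are compared.\<close>
      have "\<phi> 1 (\<phi> t (t * \<rho>)) = \<phi> (\<phi> 1 t) (t * \<rho>)" using t \<rho> by (intro assoc) auto
      moreover have "\<phi> t (t * \<rho>) = t * F \<rho>" using \<phi>[of t "t * \<rho>"] t \<rho> by simp
      moreover have "\<phi> (\<phi> 1 t) (t * \<rho>) = F t * F (t * \<rho> / F t)"
        using \<phi>[of "F t" "t * \<rho>"] t \<rho> Ft by (simp add: F_def)
      ultimately have eq: "F (t * F \<rho>) - 1 = (F t - 1) + F t * (F (t * \<rho> / F t) - 1)"
        by (simp add: F_def[symmetric] algebra_simps)
      have W': "F x - 1 = W x * x ^ k" if "x > 0" for x using that by (simp add: W_def)
      have pos: "t * F \<rho> > 0" "t * \<rho> / F t > 0" using t \<rho> Ft F\<rho> by auto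
      have "W (t * F \<rho>) * (t * F \<rho>) ^ k = W t * t ^ k + F t * (W (t * \<rho> / F t) * (t * \<rho> / F t) ^ k)"
        using eq unfolding W'[OF t(1)] W'[OF pos(1)] W'[OF pos(2)] .
      then have "t ^ k * (W (t * F \<rho>) * F \<rho> ^ k) = t ^ k * (W t + F t * W (t * \<rho> / F t) * (\<rho> / F t) ^ k)"
        by (simp add: power_mult_distrib power_divide algebra_simps)
      then show "W (t * F \<rho>) * F \<rho> ^ k = W t + F t * W (t * \<rho> / F t) * (\<rho> / F t) ^ k"
        using t by simp
    qed simp
    ultimately have "C * F \<rho> ^ k = C + 1 * C * (\<rho> / 1) ^ k"
      by (intro tendsto_unique[of "at_right (0::real)"]) (auto intro: Lim_transform_eventually)
    then have "C * F \<rho> ^ k = C * (1 + \<rho> ^ k)" by (simp add: algebra_simps)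
    then show ?thesis using C by simp
  qed
  have F0: "F 0 = 1" using F[of 0] by simp
  have \<phi>0: "\<phi> 0 t = t" if "t \<ge> 0" for t using ge[of 0 t] le[of 0 t] that by simp
  show ?thesis
  proof (rule that[OF kq(1)])
    fix s t :: real assume st: "s \<ge> 0" "t \<ge> 0"
    consider "s = 0" | "s > 0" "t = 0" | "s > 0" "t > 0" using st by linarith
    then show "\<phi> s t ^ k = s ^ k + t ^ k"
    proof cases
      case 1
      then show ?thesis using \<phi>0 st kq(1) by (simp add: power_0_left)
    next
      case 2
      then show ?thesis using \<phi>[of s 0] F0 kq(1) by (simp add: power_0_left)
    next
      case 3
      then have "\<phi> s t ^ k = s ^ k * (1 + (t / s) ^ k)"
        using \<phi>[of s t] law[of "t / s"] by (simp add: power_mult_distrib)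
      then show ?thesis using 3 by (simp add: power_divide distrib_left)
    qed
  qed
qed

section \<open>Test bodies: cubes and boxes\<close>

definition unit_cube :: "(real^'n) set" where "unit_cube = cbox (-1) 1"

lemma mem_cube: "x \<in> (unit_cube :: (real^'n) set) \<longleftrightarrow> (\<forall>i. \<bar>x $ i\<bar> \<le> 1)"
  by (auto simp: unit_cube_def mem_box_cart abs_le_iff)

lemma unit_cube_symmetric: "unit_cube \<in> symmetric_bodies"
proof (rule symmetric_bodiesI)
  have "0 \<in> (unit_cube :: (real^'n) set)" by (simp add: mem_cube)
  then show "unit_cube \<noteq> ({} :: (real^'n) set)" by blast
  show "compact (unit_cube :: (real^'n) set)" "convex (unit_cube :: (real^'n) set)"
    by (simp_all add: unit_cube_def)
qed (simp add: mem_cube)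

lemma measure_box_half_widths:
  fixes b :: "real^'n"
  assumes "\<And>i. 0 \<le> b $ i"
  shows "measure lborel (cbox (- b) b) = (\<Prod>i\<in>UNIV. 2 * b $ i)"
proof -
  have "cbox (- b) b \<noteq> {}" using assms by (auto simp: interval_ne_empty_cart)
  then have "measure lborel (cbox (- b) b) = (\<Prod>i\<in>UNIV. b $ i - (- b) $ i)"
    by (rule content_cbox_cart)
  then show ?thesis by simp
qed

text \<open>Fixing \<open>r = 1\<close> leaves a polynomial in one variable.\<close>

lemma polynomial_volumeD:
  assumes "polynomial_volume f" "K \<in> symmetric_bodies" "L \<in> symmetric_bodies"
  obtains q :: "real poly" where "\<And>s. s \<ge> 0 \<Longrightarrow> measure lebesgue (f K ((\<lambda>x. s *\<^sub>R x) ` L)) = poly q s"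
proof -
  obtain m :: nat and a where a: "\<forall>r\<ge>0. \<forall>s\<ge>0.
      measure lebesgue (f ((\<lambda>x. r *\<^sub>R x) ` K) ((\<lambda>x. s *\<^sub>R x) ` L)) = (\<Sum>i\<le>m. \<Sum>j\<le>m. a i j * r ^ i * s ^ j)"
    using bspec[OF bspec[OF assms(1)[unfolded polynomial_volume_def] assms(2)] assms(3)] by blast
  have "measure lebesgue (f K ((\<lambda>x. s *\<^sub>R x) ` L)) = poly (\<Sum>i\<le>m. \<Sum>j\<le>m. monom (a i j) j) s" if "s \<ge> 0" for s
    using spec[OF a, of 1] that by (simp add: poly_sum poly_monom)
  then show ?thesis by (rule that)
qed

section \<open>Consequences of associativity and polynomial volume for \<open>phi\<close>\<close>

locale polynomial_covariant_op = covariant_op f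
  for f :: "(real ^ 'n) set \<Rightarrow> (real ^ 'n) set \<Rightarrow> (real ^ 'n) set" +
  assumes assoc: "associative_op f" and poly_vol: "polynomial_volume f"
begin

lemma supp_fun_seg_axis: "s \<ge> 0 \<Longrightarrow> supp_fun (seg (s *\<^sub>R axis i (1::real))) (axis i 1) = s"
  by (simp add: supp_fun_seg inner_axis_axis)

lemma phi_assoc:
  assumes "r \<ge> 0" "s \<ge> 0" "t \<ge> 0"
  shows "phi r (phi s t) = phi (phi r s) t"
proof -
  fix i :: 'n
  let ?S = "\<lambda>s. seg (s *\<^sub>R axis i (1::real))"
  have "f (?S r) (f (?S s) (?S t)) = f (f (?S r) (?S s)) (?S t)"
    using assoc seg_symmetric_body unfolding associative_op_def by blast
  from arg_cong[OF this, of "\<lambda>K. supp_fun K (axis i 1)"] show ?thesis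
    using assms by (simp add: supp_fun_op closed seg_symmetric_body supp_fun_seg_axis)
qed

lemma phi_axis: 
  "s \<ge> 0 \<Longrightarrow> phi s 0 = s * phi 1 0" "s \<ge> 0 \<Longrightarrow> phi 0 s = s * phi 0 1"
  using phi_homogeneous[of 1 0 s] phi_homogeneous[of 0 1 s] by auto

text \<open>Associativity at \<open>1, 0, 0\<close> and at \<open>0, 0, 1\<close> makes the two axis
  values idempotent.\<close>

lemma phi_axis_cases: "phi 1 0 = 0 \<or> phi 1 0 = 1" "phi 0 1 = 0 \<or> phi 0 1 = 1"
proof -
  have 0: "phi 0 0 = 0" using phi_axis[of 0] by simp
  have "phi 1 0 * phi 1 0 = phi 1 0"
    using phi_assoc[of 1 0 0] phi_axis(1)[OF phi_nonneg, of 1 0] by (simp add: 0)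
  then show "phi 1 0 = 0 \<or> phi 1 0 = 1" by simp
  have "phi 0 1 * phi 0 1 = phi 0 1"
    using phi_assoc[of 0 0 1] phi_axis(2)[OF phi_nonneg, of 0 1] by (simp add: 0)
  then show "phi 0 1 = 0 \<or> phi 0 1 = 1" by simp
qed

text \<open>Dilates of one body have proportional support functions, so homogeneity of
  \<open>phi\<close> makes the result another dilate of that body.\<close>

lemma op_cube: 
  assumes "r \<ge> 0" "s \<ge> 0"
  shows "f ((\<lambda>x. r *\<^sub>R x) ` unit_cube) ((\<lambda>x. s *\<^sub>R x) ` unit_cube) = (\<lambda>x. phi r s *\<^sub>R x) ` unit_cube"
proof (rule supp_fun_inject)
  show "supp_fun (f ((\<lambda>x. r *\<^sub>R x) ` unit_cube) ((\<lambda>x. s *\<^sub>R x) ` unit_cube)) u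
      = supp_fun ((\<lambda>x. phi r s *\<^sub>R x) ` unit_cube) u" for u
    using assms phi_homogeneous[of r s "supp_fun unit_cube u"]
    by (simp add: supp_fun_op symmetric_bodies_scale unit_cube_symmetric supp_fun_scale_body supp_fun_nonneg phi_nonneg mult.commute)
qed (intro closed symmetric_bodies_scale unit_cube_symmetric)+

text \<open>The dilate of the cube by \<open>phi 1 t\<close> has volume \<open>2 ^ CARD('n)\<close>
  times the \<open>CARD('n)\<close>-th power of the factor.\<close>

lemma phi_power_poly:
  obtains p where "\<And>t. t \<ge> 0 \<Longrightarrow> phi 1 t ^ CARD('n) = poly p t"
proof -
  obtain q where q: "\<And>s. s \<ge> 0 \<Longrightarrow> measure lebesgue (f unit_cube ((\<lambda>x. s *\<^sub>R x) ` unit_cube)) = poly q s"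
    using polynomial_volumeD[OF poly_vol unit_cube_symmetric unit_cube_symmetric] by blast
  have cube: "measure lebesgue (unit_cube :: (real^'n) set) = 2 ^ CARD('n)"
    using measure_box_half_widths[of "1 :: real^'n"] by (simp add: unit_cube_def)
  have "phi 1 t ^ CARD('n) = poly (smult (1 / 2 ^ CARD('n)) q) t" if t: "t \<ge> 0" for t
  proof -
    have "poly q t = measure lebesgue ((\<lambda>x. phi 1 t *\<^sub>R x + 0) ` (unit_cube :: (real^'n) set))"
      using q[OF t] op_cube[of 1 t] t by simp
    also have "\<dots> = \<bar>phi 1 t\<bar> ^ DIM(real^'n) * measure lebesgue (unit_cube :: (real^'n) set)"
      by (rule measure_lebesgue_affine)
    finally show ?thesis using cube phi_nonneg[of 1 t] by simp
  qed
  then show ?thesis by (rule that)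
qed

text \<open>The volume of \<open>M s\<close>, the operation applied to the cube and a segment of
  half-length \<open>s\<close>, is squeezed between boxes. Outer boxes give a linear bound and, by
  the power law, a bound in \<open>s ^ k\<close>; an inner box gives volume \<open>s\<close>. For
  \<open>k \<ge> 2\<close> these contradict \<open>no_polynomial_growth\<close>.\<close>

lemma polynomial_volume_imp_exponent_1:
  assumes k: "k \<ge> 1" and \<phi>: "\<And>s t. s \<ge> 0 \<Longrightarrow> t \<ge> 0 \<Longrightarrow> phi s t ^ k = s ^ k + t ^ k"
    and ge: "\<And>s t. s \<ge> 0 \<Longrightarrow> t \<ge> 0 \<Longrightarrow> s \<le> phi s t \<and> t \<le> phi s t"
    and le: "\<And>s t. s \<ge> 0 \<Longrightarrow> t \<ge> 0 \<Longrightarrow> phi s t \<le> s + t"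
  shows "k = 1"
proof (rule ccontr)
  assume "k \<noteq> 1"
  with k have k2: "k \<ge> 2" by simp
  fix i :: 'n
  let ?e = "axis i (1::real)"
  let ?Q = "unit_cube :: (real^'n) set"
  obtain q where q: "\<And>s. s \<ge> 0 \<Longrightarrow> measure lebesgue (f ?Q ((\<lambda>x. s *\<^sub>R x) ` seg ?e)) = poly q s"
    using polynomial_volumeD[OF poly_vol unit_cube_symmetric seg_symmetric_body] by blast
  have seg: "(\<lambda>x. s *\<^sub>R x) ` seg ?e = seg (s *\<^sub>R ?e)" for s
    by (simp add: seg_def image_image mult.commute)
  define M where "M s = f ?Q (seg (s *\<^sub>R ?e))" for s
  have qM: "poly q s = measure lebesgue (M s)" if "s \<ge> 0" for s
    using q[OF that] by (simp add: seg M_def)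
  have MS: "M s \<in> symmetric_bodies" for s
    unfolding M_def by (intro closed unit_cube_symmetric seg_symmetric_body)
  note MD = symmetric_bodiesD[OF MS]
  have M: "M s \<in> lmeasurable" for s using MD(2) by (rule lmeasurable_compact)
  have hM: "supp_fun (M s) u = phi (supp_fun ?Q u) (\<bar>s\<bar> * \<bar>u $ i\<bar>)" for s u
    by (simp add: M_def supp_fun_op unit_cube_symmetric seg_symmetric_body supp_fun_seg inner_axis' abs_mult)
  have hQ: "supp_fun ?Q (axis j 1) = 1" for j
    by (rule supp_fun_eqI[of 1]) (auto simp: mem_cube inner_axis abs_le_iff)
  have coord: "\<bar>x $ j\<bar> \<le> phi 1 (if j = i then s else 0)" if "x \<in> M s" "s \<ge> 0" for x s j
  proof -
    have "\<bar>x $ j\<bar> \<le> supp_fun (M s) (axis j 1)"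
      using supp_fun_ge[OF MD(2) that(1), of "axis j 1"] supp_fun_ge[OF MD(2) MD(4)[OF that(1)], of "axis j 1"]
      by (simp add: inner_axis abs_le_iff)
    moreover have "axis j (1::real) $ i = (if j = i then 1 else 0)" by (simp add: axis_def)
    ultimately show ?thesis using that(2) by (simp add: hM hQ split: if_splits)
  qed
  have upper: "measure lebesgue (M s) \<le> (\<Prod>j\<in>UNIV. 2 * b $ j)"
    if s: "s \<ge> 0" and b: "\<And>j. phi 1 (if j = i then s else 0) \<le> b $ j" for s and b :: "real^'n"
  proof -
    have "0 \<le> b $ j" for j by (rule order.trans[OF phi_nonneg b])
    moreover have "M s \<subseteq> cbox (- b) b"
    proof
      fix x assume x: "x \<in> M s"
      have "\<bar>x $ j\<bar> \<le> b $ j" for j by (rule order.trans[OF coord[OF x s] b])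
      then show "x \<in> cbox (- b) b" by (auto simp: mem_box_cart abs_le_iff minus_le_iff)
    qed
    then have "measure lebesgue (M s) \<le> measure lebesgue (cbox (- b) b)"
      by (intro measure_mono_fmeasurable) (use M in auto)
    ultimately show ?thesis by (simp add: measure_box_half_widths)
  qed
  have phi10: "phi 1 0 = 1" using ge[of 1 0] le[of 1 0] by simp
  have prod_if: "(\<Prod>j\<in>UNIV. 2 * (\<chi> j. if j = i then c else d) $ j) = 2 * c * (2 * d) ^ (CARD('n) - 1)" for c d :: real
  proof -
    have "(\<Prod>j\<in>UNIV. 2 * (\<chi> j. if j = i then c else d) $ j) = 2 * c * (\<Prod>j\<in>UNIV-{i}. 2 * (\<chi> j. if j = i then c else d) $ j)"
      by (subst prod.remove[of UNIV i]) auto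
    also have "(\<Prod>j\<in>UNIV-{i}. 2 * (\<chi> j. if j = i then c else d) $ j) = (\<Prod>j\<in>UNIV-{i}. 2 * d)"
      by (intro prod.cong) auto
    finally show ?thesis by (simp add: card_Diff_singleton)
  qed
  let ?A = "2 ^ CARD('n) :: real"
  have A: "?A = 2 * 2 ^ (CARD('n) - 1)"
    using power_Suc[of "2::real" "CARD('n) - 1"] by simp
  show False
  proof (rule no_polynomial_growth[OF k2, of ?A q "CARD('n)"])
    fix s :: real assume s: "s \<ge> 0"
    have "phi 1 (if j = i then s else 0) \<le> (\<chi> j. if j = i then 1 + s else 1) $ j" for j
      using le[of 1 s] s phi10 by simp
    from upper[OF s this] show "poly q s \<le> ?A * (1 + s)"
      unfolding prod_if qM[OF s] A by (simp add: algebra_simps)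
    have "phi 1 (if j = i then s else 0) \<le> (\<chi> j. 1 + s ^ k) $ j" for j
    proof -
      \<comment> \<open>The power law gives \<open>1 + s ^ k\<close> on the left; a number that is
        at least 1 is bounded by its \<open>k\<close>-th power.\<close>
      have "phi 1 s ^ k \<le> (1 + s ^ k) ^ k"
        using \<phi>[of 1 s] s k self_le_power[of "1 + s ^ k" k] by simp
      then have "phi 1 s \<le> 1 + s ^ k" using k s by (cases k) (auto intro: power_le_imp_le_base)
      then show ?thesis using phi10 s by simp
    qed
    from upper[OF s this] show "poly q s \<le> ?A * (1 + s ^ k) ^ CARD('n)"
      unfolding qM[OF s] by (simp add: power_mult_distrib[symmetric])
    \<comment> \<open>The half-widths are chosen so that this box has volume exactly
      \<open>s\<close>.\<close>
    let ?b = "(\<chi> j. if j = i then s / 2 else 1 / 2) :: real^'n"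
    have "cbox (- ?b) ?b \<subseteq> M s"
    proof
      fix x assume "x \<in> cbox (- ?b) ?b"
      then have x: "\<bar>x $ j\<bar> \<le> ?b $ j" for j by (simp add: mem_box_cart abs_le_iff minus_le_iff)
      \<comment> \<open>Then \<open>x\<close> is its component along \<open>?e\<close> plus
        \<open>z / 2\<close>, where \<open>z\<close> lies in the cube. So
        \<open>x \<bullet> u\<close> is at most the average of the support values of cube and
        segment, and both are bounded by \<open>phi\<close>.\<close>
      define z where "z = 2 *\<^sub>R (x - (x $ i) *\<^sub>R ?e)"
      have z: "z \<in> ?Q"
      proof (unfold mem_cube, rule allI)
        fix j show "\<bar>z $ j\<bar> \<le> 1"
          using x[of j] by (cases "j = i") (simp_all add: z_def axis_def abs_mult)
      qed
      have "x \<bullet> u \<le> supp_fun (M s) u" for u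
      proof -
        have "z \<bullet> u = 2 * (x \<bullet> u) - 2 * (x $ i * u $ i)"
          by (simp add: z_def inner_diff_left inner_axis' algebra_simps)
        then have "x \<bullet> u = x $ i * u $ i + (z \<bullet> u) / 2" by (simp add: field_simps)
        also have "\<dots> \<le> (s * \<bar>u $ i\<bar>) / 2 + supp_fun ?Q u / 2"
        proof (intro add_mono divide_right_mono)
          have "x $ i * u $ i \<le> \<bar>x $ i\<bar> * \<bar>u $ i\<bar>" by (metis abs_ge_self abs_mult)
          also have "\<dots> \<le> (s / 2) * \<bar>u $ i\<bar>" using x[of i] by (intro mult_right_mono) auto
          finally show "x $ i * u $ i \<le> (s * \<bar>u $ i\<bar>) / 2" by simp
        qed (use supp_fun_ge[OF symmetric_bodiesD(2)[OF unit_cube_symmetric] z] in auto)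
        also have "\<dots> \<le> supp_fun (M s) u"
          using ge[of "supp_fun ?Q u" "s * \<bar>u $ i\<bar>"] s by (simp add: hM supp_fun_nonneg unit_cube_symmetric)
        finally show ?thesis .
      qed
      then show "x \<in> M s" using mem_iff_inner_le_supp_fun[OF MD(2,3,1)] by blast
    qed
    then have "measure lebesgue (cbox (- ?b) ?b) \<le> measure lebesgue (M s)"
      by (intro measure_mono_fmeasurable) (use M in auto)
    moreover have "measure lebesgue (cbox (- ?b) ?b) = s"
    proof -
      have "0 \<le> ?b $ j" for j using s by simp
      from measure_box_half_widths[OF this] show ?thesis unfolding prod_if by simp
    qed
    ultimately show "s \<le> poly q s" using qM[OF s] by simp
  next
    have "M 0 = ?Q"
    proof (rule supp_fun_inject[OF MS unit_cube_symmetric])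
      fix u show "supp_fun (M 0) u = supp_fun ?Q u"
        using phi_axis(1)[OF supp_fun_nonneg[OF unit_cube_symmetric], of u] by (simp add: hM phi10)
    qed
    then show "poly q 0 = ?A"
      using qM[of 0] measure_box_half_widths[of "1 :: real^'n"] by (simp add: unit_cube_def)
  qed simp
qed

text \<open>There are four possible pairs of axis values. Unless both equal 1, the lower and upper
  bounds on \<open>phi\<close> coincide; otherwise the power law applies and its exponent must be
  1.\<close>

theorem classification:
  "(\<forall>K\<in>symmetric_bodies. \<forall>L\<in>symmetric_bodies. f K L = {0}) \<or>
   (\<forall>K\<in>symmetric_bodies. \<forall>L\<in>symmetric_bodies. f K L = K) \<or>
   (\<forall>K\<in>symmetric_bodies. \<forall>L\<in>symmetric_bodies. f K L = L) \<or>
   (\<forall>K\<in>symmetric_bodies. \<forall>L\<in>symmetric_bodies. f K L = K + L)"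
proof -
  have zero: "{0} \<in> symmetric_bodies" by (rule symmetric_bodiesI) auto
  have supp0: "supp_fun {0} u = 0" for u :: "real^'n" by (rule supp_fun_eqI[of 0]) auto
  have bounds: "s * phi 1 0 \<le> phi s t" "t * phi 0 1 \<le> phi s t" "phi s t \<le> s * phi 1 0 + t * phi 0 1"
    if "s \<ge> 0" "t \<ge> 0" for s t
    using phi_bounds[OF that] phi_axis(1)[OF that(1)] phi_axis(2)[OF that(2)] by linarith+
  consider "phi 1 0 = 0" "phi 0 1 = 0" | "phi 1 0 = 1" "phi 0 1 = 0" | "phi 1 0 = 0" "phi 0 1 = 1"
    | "phi 1 0 = 1" "phi 0 1 = 1" using phi_axis_cases by blast
  then show ?thesis
  proof cases
    case 1
    have "phi s t = 0" if "s \<ge> 0" "t \<ge> 0" for s t using bounds[OF that] 1 by simp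
    then have "f K L = {0}" if "K \<in> symmetric_bodies" "L \<in> symmetric_bodies" for K L
      using op_eqI[of "\<lambda>K L. {0}" K L] that zero by (simp add: supp_fun_nonneg supp0)
    then show ?thesis by blast
  next
    case 2
    have "phi s t = s" if "s \<ge> 0" "t \<ge> 0" for s t using bounds[OF that] 2 by simp
    then have "f K L = K" if "K \<in> symmetric_bodies" "L \<in> symmetric_bodies" for K L
      using op_eqI[of "\<lambda>K L. K" K L] that by (simp add: supp_fun_nonneg)
    then show ?thesis by blast
  next
    case 3
    have "phi s t = t" if "s \<ge> 0" "t \<ge> 0" for s t using bounds[OF that] 3 by simp
    then have "f K L = L" if "K \<in> symmetric_bodies" "L \<in> symmetric_bodies" for K L
      using op_eqI[of "\<lambda>K L. L" K L] that by (simp add: supp_fun_nonneg)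
    then show ?thesis by blast
  next
    case 4
    have ge: "s \<le> phi s t \<and> t \<le> phi s t" and le: "phi s t \<le> s + t" if "s \<ge> 0" "t \<ge> 0" for s t
      using bounds[OF that] 4 by simp_all
    obtain p where p: "\<And>t. t \<ge> 0 \<Longrightarrow> phi 1 t ^ CARD('n) = poly p t" by (rule phi_power_poly) blast
    obtain k where k: "k \<ge> 1" "\<And>s t. s \<ge> 0 \<Longrightarrow> t \<ge> 0 \<Longrightarrow> phi s t ^ k = s ^ k + t ^ k"
      using power_law_of_associative[of phi "CARD('n)" p, OF phi_homogeneous phi_assoc ge le _ p] by auto
    from polynomial_volume_imp_exponent_1[OF k ge le] have "k = 1" by blast
    with k(2) have "phi s t = s + t" if "s \<ge> 0" "t \<ge> 0" for s t using that by simp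
    then have "f K L = K + L" if "K \<in> symmetric_bodies" "L \<in> symmetric_bodies" for K L
      using op_eqI[of "\<lambda>K L. K + L" K L, OF symmetric_bodies_set_plus _ that]
      by (simp add: supp_fun_nonneg supp_fun_set_plus symmetric_bodiesD)
    then show ?thesis by blast
  qed
qed

end

subsection \<open>The four operations\<close>

text \<open>Existence comes from the orthogonal decomposition. The difference of two candidates lies
  in \<open>S\<close> and is orthogonal to itself, so the description in \<open>orth_proj\<close> is
  unambiguous.\<close>

lemma orth_proj:
  fixes S :: "(real^'n) set"
  assumes "subspace S"
  shows "orth_proj S x \<in> S" "z \<in> S \<Longrightarrow> orthogonal (x - orth_proj S x) z"
    and orth_proj_eqI: "\<And>y. y \<in> S \<Longrightarrow> (\<And>z. z \<in> S \<Longrightarrow> orthogonal (x - y) z) \<Longrightarrow> orth_proj S x = y"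
proof -
  have uniq: "y = y'" if y: "y \<in> S" "\<forall>z\<in>S. orthogonal (x - y) z" and y': "y' \<in> S" "\<forall>z\<in>S. orthogonal (x - y') z" for y y'
  proof -
    have "y - y' \<in> S" using assms y y' by (intro subspace_diff)
    then have "orthogonal (x - y) (y - y')" "orthogonal (x - y') (y - y')" using y y' by auto
    then have "(y - y') \<bullet> (y - y') = 0" by (simp add: orthogonal_def inner_diff_left)
    then show ?thesis by simp
  qed
  obtain y w where yw: "y \<in> span S" "\<And>w'. w' \<in> span S \<Longrightarrow> orthogonal w w'" "x = y + w"
    using orthogonal_subspace_decomp_exists[of S x] by blast
  have y: "y \<in> S" "\<forall>z\<in>S. orthogonal (x - y) z"
    using yw span_eq_iff[THEN iffD2, OF assms] by auto
  show eqI: "orth_proj S x = y" if "y \<in> S" "\<And>z. z \<in> S \<Longrightarrow> orthogonal (x - y) z" for y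
    unfolding orth_proj_def using that uniq by (intro the_equality) blast+
  have "orth_proj S x = y" using y by (intro eqI) auto
  with y show "orth_proj S x \<in> S" "z \<in> S \<Longrightarrow> orthogonal (x - orth_proj S x) z" by auto
qed

lemma linear_orth_proj:
  fixes S :: "(real^'n) set"
  assumes "subspace S" shows "linear (orth_proj S)"
proof (rule linearI)
  note p = orth_proj(1)[OF assms] and o = orth_proj(2)[OF assms]
  show "orth_proj S (x + y) = orth_proj S x + orth_proj S y" for x y
  proof (rule orth_proj_eqI[OF assms])
    show "orth_proj S x + orth_proj S y \<in> S" using assms p by (intro subspace_add)
    show "orthogonal (x + y - (orth_proj S x + orth_proj S y)) z" if "z \<in> S" for z
      using o[OF that, of x] o[OF that, of y] by (simp add: orthogonal_def inner_diff_left inner_add_left)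
  qed
  show "orth_proj S (c *\<^sub>R x) = c *\<^sub>R orth_proj S x" for c x
  proof (rule orth_proj_eqI[OF assms])
    show "c *\<^sub>R orth_proj S x \<in> S" using assms p by (intro subspace_scale)
    show "orthogonal (c *\<^sub>R x - c *\<^sub>R orth_proj S x) z" if "z \<in> S" for z
      using o[OF that, of x] by (simp add: orthogonal_def inner_diff_left)
  qed
qed

lemma linear_image_set_plus:
  assumes "linear h" shows "h ` (K + L) = h ` K + h ` L"
proof -
  have "h ` (K + L) \<subseteq> h ` K + h ` L"
    by (auto simp: linear_add[OF assms] elim!: set_plus_elim intro!: set_plus_intro)
  moreover have "h ` K + h ` L \<subseteq> h ` (K + L)"
    by (auto simp: linear_add[OF assms, symmetric] elim!: set_plus_elim intro!: imageI set_plus_intro)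
  ultimately show ?thesis by blast
qed

text \<open>All four operations commute with every linear map, and orthogonal projections are
  linear.\<close>

lemma projection_covariantI:
  fixes f :: "(real ^ 'n) set \<Rightarrow> (real ^ 'n) set \<Rightarrow> (real ^ 'n) set"
  assumes "\<And>h K L. linear h \<Longrightarrow> K \<in> symmetric_bodies \<Longrightarrow> L \<in> symmetric_bodies \<Longrightarrow> h ` f K L = f (h ` K) (h ` L)"
  shows "projection_covariant f"
  unfolding projection_covariant_def
  by (intro ballI allI impI, elim conjE, rule assms) (auto intro: linear_orth_proj)

lemma polynomial_volumeI:
  fixes f :: "(real ^ 'n) set \<Rightarrow> (real ^ 'n) set \<Rightarrow> (real ^ 'n) set"
  assumes "\<And>K L. K \<in> symmetric_bodies \<Longrightarrow> L \<in> symmetric_bodies \<Longrightarrow> \<exists>m a. \<forall>r\<ge>0. \<forall>s\<ge>0.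
     measure lebesgue (f ((\<lambda>x. r *\<^sub>R x) ` K) ((\<lambda>x. s *\<^sub>R x) ` L)) = (\<Sum>i\<le>m. \<Sum>j\<le>m. a i j * r ^ i * s ^ j)"
  shows "polynomial_volume f"
  unfolding polynomial_volume_def by (intro ballI assms)

lemma measure_scale_cart:
  fixes K :: "(real^'n) set"
  assumes "r \<ge> 0" shows "measure lebesgue ((\<lambda>x. r *\<^sub>R x) ` K) = r ^ CARD('n) * measure lebesgue K"
  using measure_lebesgue_affine[of r 0 K] assms by simp

lemma op_left_properties:
  fixes f :: "(real ^ 'n) set \<Rightarrow> (real ^ 'n) set \<Rightarrow> (real ^ 'n) set"
  assumes f: "\<And>K L. K \<in> symmetric_bodies \<Longrightarrow> L \<in> symmetric_bodies \<Longrightarrow> f K L = K"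
  shows "projection_covariant f \<and> associative_op f \<and> polynomial_volume f"
proof (intro conjI)
  show "projection_covariant f"
    by (rule projection_covariantI) (simp add: f symmetric_bodies_linear_image)
  show "associative_op f"
    by (simp add: associative_op_def f)
  show "polynomial_volume f"
  proof (rule polynomial_volumeI)
    fix K L :: "(real^'n) set" assume K: "K \<in> symmetric_bodies" and L: "L \<in> symmetric_bodies"
    let ?n = "CARD('n)"
    show "\<exists>m a. \<forall>r\<ge>0. \<forall>s\<ge>0. measure lebesgue (f ((\<lambda>x. r *\<^sub>R x) ` K) ((\<lambda>x. s *\<^sub>R x) ` L))
        = (\<Sum>i\<le>m. \<Sum>j\<le>m. a i j * r ^ i * s ^ j)"
    \<comment> \<open>The witnesses are fixed by the closing equation: the only nonzero coefficient
      can be the volume of \<open>K\<close> at \<open>r ^ ?n * s ^ 0\<close>.\<close>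
    proof (intro exI allI impI)
      fix r s :: real assume "r \<ge> 0" "s \<ge> 0"
      have "(\<Sum>j\<le>?n. (if i = ?n then if j = 0 then measure lebesgue K else 0 else 0) * r ^ i * s ^ j)
          = (if i = ?n then r ^ i * measure lebesgue K else 0)" for i
        by (simp add: sum.atMost_shift)
      then have "(\<Sum>i\<le>?n. \<Sum>j\<le>?n. (if i = ?n then if j = 0 then measure lebesgue K else 0 else 0) * r ^ i * s ^ j)
          = r ^ ?n * measure lebesgue K"
        by simp
      also have "\<dots> = measure lebesgue (f ((\<lambda>x. r *\<^sub>R x) ` K) ((\<lambda>x. s *\<^sub>R x) ` L))"
        using \<open>r \<ge> 0\<close> by (simp add: f K L symmetric_bodies_scale measure_scale_cart)
      finally show "measure lebesgue (f ((\<lambda>x. r *\<^sub>R x) ` K) ((\<lambda>x. s *\<^sub>R x) ` L))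
        = (\<Sum>i\<le>?n. \<Sum>j\<le>?n. (if i = ?n then if j = 0 then measure lebesgue K else 0 else 0) * r ^ i * s ^ j)" ..
    qed
  qed
qed

text \<open>All three properties survive exchanging the arguments, with the coefficient array
  transposed. This reduces the second projection \<open>f K L = L\<close> to the first.\<close>

lemma op_flip_properties:
  assumes "projection_covariant f \<and> associative_op f \<and> polynomial_volume f"
  shows "projection_covariant (\<lambda>K L. f L K) \<and> associative_op (\<lambda>K L. f L K) \<and> polynomial_volume (\<lambda>K L. f L K)"
proof (intro conjI)
  show "projection_covariant (\<lambda>K L. f L K)"
    using assms unfolding projection_covariant_def by blast
  show "associative_op (\<lambda>K L. f L K)"
    using assms unfolding associative_op_def by metis
  show "polynomial_volume (\<lambda>K L. f L K)"
  proof (rule polynomial_volumeI)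
    fix K L :: "(real^'a) set" assume KL: "K \<in> symmetric_bodies" "L \<in> symmetric_bodies"
    obtain m :: nat and a where a: "\<forall>s\<ge>0. \<forall>r\<ge>0.
        measure lebesgue (f ((\<lambda>x. s *\<^sub>R x) ` L) ((\<lambda>x. r *\<^sub>R x) ` K)) = (\<Sum>i\<le>m. \<Sum>j\<le>m. a i j * s ^ i * r ^ j)"
      using assms KL unfolding polynomial_volume_def by blast
    have "(\<Sum>i\<le>m. \<Sum>j\<le>m. a i j * s ^ i * r ^ j) = (\<Sum>i\<le>m. \<Sum>j\<le>m. a j i * r ^ i * s ^ j)" for r s
      by (subst sum.swap) (simp add: mult_ac)
    with a show "\<exists>m a. \<forall>r\<ge>0. \<forall>s\<ge>0. measure lebesgue (f ((\<lambda>x. s *\<^sub>R x) ` L) ((\<lambda>x. r *\<^sub>R x) ` K))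
        = (\<Sum>i\<le>m. \<Sum>j\<le>m. a i j * r ^ i * s ^ j)"
      by (intro exI[of _ m] exI[of _ "\<lambda>i j. a j i"]) simp
  qed
qed

lemma op_zero_properties:
  fixes f :: "(real ^ 'n) set \<Rightarrow> (real ^ 'n) set \<Rightarrow> (real ^ 'n) set"
  assumes f: "\<And>K L. K \<in> symmetric_bodies \<Longrightarrow> L \<in> symmetric_bodies \<Longrightarrow> f K L = {0}"
  shows "projection_covariant f \<and> associative_op f \<and> polynomial_volume f"
proof (intro conjI)
  show "projection_covariant f"
    by (rule projection_covariantI) (simp add: f symmetric_bodies_linear_image linear_0)
  have "{0 :: real^'n} \<in> symmetric_bodies" by (rule symmetric_bodiesI) auto
  then show "associative_op f"
    by (simp add: associative_op_def f)
  show "polynomial_volume f"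
    by (rule polynomial_volumeI, rule exI[of _ 0], rule exI[of _ "\<lambda>i j. 0"]) (simp add: f symmetric_bodies_scale)
qed

lemma op_plus_properties:
  fixes f :: "(real ^ 'n) set \<Rightarrow> (real ^ 'n) set \<Rightarrow> (real ^ 'n) set"
  assumes f: "\<And>K L. K \<in> symmetric_bodies \<Longrightarrow> L \<in> symmetric_bodies \<Longrightarrow> f K L = K + L"
  shows "projection_covariant f \<and> associative_op f \<and> polynomial_volume f"
proof (intro conjI)
  show "projection_covariant f"
    by (rule projection_covariantI) (simp add: f symmetric_bodies_linear_image linear_image_set_plus)
  show "associative_op f"
    by (simp add: associative_op_def f symmetric_bodies_set_plus add.assoc)
  show "polynomial_volume f"
  proof (rule polynomial_volumeI)
    fix K L :: "(real^'n) set" assume K: "K \<in> symmetric_bodies" and L: "L \<in> symmetric_bodies"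
    let ?V = "\<lambda>r s. measure lebesgue (mink_comb r s K L)"
    obtain a where a: "\<And>r s. mink_poly ?V CARD('n) r s = (\<Sum>k\<le>CARD('n). \<Sum>l\<le>CARD('n). a k l * r ^ k * s ^ l)"
      using mink_poly_expand[of ?V "CARD('n)"] by blast
    have "measure lebesgue (f ((\<lambda>x. r *\<^sub>R x) ` K) ((\<lambda>x. s *\<^sub>R x) ` L)) = (\<Sum>k\<le>CARD('n). \<Sum>l\<le>CARD('n). a k l * r ^ k * s ^ l)"
      if "r \<ge> 0" "s \<ge> 0" for r s
    proof -
      have "f ((\<lambda>x. r *\<^sub>R x) ` K) ((\<lambda>x. s *\<^sub>R x) ` L) = mink_comb r s K L"
        by (simp add: f K L symmetric_bodies_scale mink_comb_def)
      then show ?thesis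
        using measure_mink_comb_eq_mink_poly[OF symmetric_bodiesD(2,3,1)[OF K] symmetric_bodiesD(2,3,1)[OF L] that]
        unfolding a by simp
    qed
    then show "\<exists>m a. \<forall>r\<ge>0. \<forall>s\<ge>0. measure lebesgue (f ((\<lambda>x. r *\<^sub>R x) ` K) ((\<lambda>x. s *\<^sub>R x) ` L))
        = (\<Sum>i\<le>m. \<Sum>j\<le>m. a i j * r ^ i * s ^ j)"
      by blast
  qed
qed

theorem theoremE:
  fixes f :: "(real ^ 'n) set \<Rightarrow> (real ^ 'n) set \<Rightarrow> (real ^ 'n) set"
  assumes "CARD('n) \<ge> 2"
    and "\<And>K L. K \<in> symmetric_bodies \<Longrightarrow> L \<in> symmetric_bodies \<Longrightarrow> f K L \<in> symmetric_bodies"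
  shows "projection_covariant f \<and> associative_op f \<and> polynomial_volume f \<longleftrightarrow>
      (\<forall>K\<in>symmetric_bodies. \<forall>L\<in>symmetric_bodies. f K L = {0}) \<or>
      (\<forall>K\<in>symmetric_bodies. \<forall>L\<in>symmetric_bodies. f K L = K) \<or>
      (\<forall>K\<in>symmetric_bodies. \<forall>L\<in>symmetric_bodies. f K L = L) \<or>
      (\<forall>K\<in>symmetric_bodies. \<forall>L\<in>symmetric_bodies. f K L = K + L)"
    (is "?P \<longleftrightarrow> ?Q")
proof
  assume ?P
  then interpret polynomial_covariant_op f
    by unfold_locales (use assms in auto)
  show ?Q by (rule classification)
next
  assume ?Q
  then consider "\<And>K L. K \<in> symmetric_bodies \<Longrightarrow> L \<in> symmetric_bodies \<Longrightarrow> f K L = {0}"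
    | "\<And>K L. K \<in> symmetric_bodies \<Longrightarrow> L \<in> symmetric_bodies \<Longrightarrow> f K L = K"
    | "\<And>K L. K \<in> symmetric_bodies \<Longrightarrow> L \<in> symmetric_bodies \<Longrightarrow> f K L = L"
    | "\<And>K L. K \<in> symmetric_bodies \<Longrightarrow> L \<in> symmetric_bodies \<Longrightarrow> f K L = K + L"
    by blast
  then show ?P
  proof cases
    case 1 then show ?thesis by (rule op_zero_properties)
  next
    case 2 then show ?thesis by (rule op_left_properties)
  next
    case 3
    then have "projection_covariant (\<lambda>K L. f L K) \<and> associative_op (\<lambda>K L. f L K) \<and> polynomial_volume (\<lambda>K L. f L K)"
      by (intro op_left_properties)
    then show ?thesis using op_flip_properties[of "\<lambda>K L. f L K"] by simp
  next
    case 4 then show ?thesis by (rule op_plus_properties)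
  qed
qed

end
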